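(* Assume that (H1)-(H2) hold. For all $g_0\in E^2(p,w)$ such that $g_0>0$, the sequence of intervals \begin{equation*} I_n=\left[\inf \frac{\widetilde{\mathcal{L}} ^{n+1} g_0}{\widetilde{\mathcal{L}} ^n g_0},\sup \frac{\widetilde{\mathcal{L}} ^{n+1} g_0}{\widetilde{\mathcal{L}} ^n g_0}\right] \end{equation*} satisfies $I_{n+1}\subset I_n$ for all $n\in\mathbb{N}$ and $C(p,w)\in \bigcap_{n\in\mathbb{N}}I_n$.
   Context: Let $-\infty\le a<b\le\infty$, let $p\in L^1(]a,b[)$ be a probability density with $p>0$ a.e. on $]a,b[$, and let $w\in L^1_{\text{loc}}(]a,b[)$ be a weight with $w>0$ a.e. and $pw\in L^1_{\text{loc}}(]a,b[)$. Let $P(x)=\int_a^x p$, $\bar P=1-P$, and $K(x,y)=P(x\wedge y)\bar P(x\vee y)$. $H^1(p,w)$ is the set of weakly differentiable $h\in L^2(p)$ with $h'\in L^2(pw)$, and $C(p,w)$ is the smallest constant $C$ with $\mathrm{Var}_p[h]\le C\,\mathbb{E}_p[|h'|^2w]$ for all $h\in H^1(p,w)$. Hypotheses: (H1) $C(p,w)<\infty$; (H2) $L^2(pw)\subset L^1_{\text{loc}}(]a,b[)$. $E^2(p,w)=\{f\in L^2(pw)\cap L^1_{\text{loc}}(]a,b[): x\mapsto \int_{x_0}^x f\in L^2(p)\}$ (any fixed $x_0\in]a,b[$), with the $L^2(pw)$ norm; under (H1)-(H2) it equals $L^2(pw)$. The pseudo-inverse Sturm-Liouville operator is $\widetilde{\mathcal{L}}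 f(x)=\frac{1}{p(x)w(x)}\int_a^b K(x,y)f(y)\,dy$, with iterates $\widetilde{\mathcal{L}}^0 f=f$, $\widetilde{\mathcal{L}}^{n+1}=\widetilde{\mathcal{L}}(\widetilde{\mathcal{L}}^n)$. $\inf,\sup$ denote essential infimum/supremum over $]a,b[$. *)

theory Defs
  imports "HOL-Analysis.Analysis"
begin

definition oint :: "ereal \<Rightarrow> ereal \<Rightarrow> real set" where
  "oint a b = {x::real. a < ereal x \<and> ereal x < b}"

definition loc_int :: "ereal \<Rightarrow> ereal \<Rightarrow> (real \<Rightarrow> real) \<Rightarrow> bool" where
  "loc_int a b f \<longleftrightarrow> (\<forall>c d. a < ereal c \<and> ereal d < b \<longrightarrow> set_integrable lborel {c..d} f)"

definition L2w :: "ereal \<Rightarrow> ereal \<Rightarrow> (real \<Rightarrow> real) \<Rightarrow> (real \<Rightarrow> real) \<Rightarrow> bool" where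
  "L2w a b q f \<longleftrightarrow> f \<in> borel_measurable lborel \<and>
     set_integrable lborel (oint a b) (\<lambda>x. (f x)\<^sup>2 * q x)"

definition weak_deriv :: "ereal \<Rightarrow> ereal \<Rightarrow> (real \<Rightarrow> real) \<Rightarrow> (real \<Rightarrow> real) \<Rightarrow> bool" where
  "weak_deriv a b h h' \<longleftrightarrow> loc_int a b h \<and> loc_int a b h' \<and>
     (\<forall>\<phi> \<phi>'. (\<forall>x. (\<phi> has_real_derivative \<phi>' x) (at x)) \<and> continuous_on UNIV \<phi>' \<and>
        (\<exists>c d. a < ereal c \<and> ereal d < b \<and> (\<forall>x. x \<notin> {c..d} \<longrightarrow> \<phi> x = 0)) \<longrightarrow>
        (LINT x:oint a b|lborel. h x * \<phi>' x) = - (LINT x:oint a b|lborel. h' x * \<phi> x))"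

definition Var_p :: "ereal \<Rightarrow> ereal \<Rightarrow> (real \<Rightarrow> real) \<Rightarrow> (real \<Rightarrow> real) \<Rightarrow> real" where
  "Var_p a b p h = (LINT x:oint a b|lborel. (h x)\<^sup>2 * p x) - (LINT x:oint a b|lborel. h x * p x)\<^sup>2"

definition poincare_consts :: "ereal \<Rightarrow> ereal \<Rightarrow> (real \<Rightarrow> real) \<Rightarrow> (real \<Rightarrow> real) \<Rightarrow> real set" where
  "poincare_consts a b p w = {C. C \<ge> 0 \<and> (\<forall>h h'. L2w a b p h \<and> weak_deriv a b h h' \<and>
      L2w a b (\<lambda>x. p x * w x) h' \<longrightarrow>
      Var_p a b p h \<le> C * (LINT x:oint a b|lborel. (h' x)\<^sup>2 * w x * p x))}"

definition Cpw :: "ereal \<Rightarrow> ereal \<Rightarrow> (real \<Rightarrow> real) \<Rightarrow> (real \<Rightarrow> real) \<Rightarrow> real" where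
  "Cpw a b p w = Inf (poincare_consts a b p w)"

definition cdf :: "ereal \<Rightarrow> (real \<Rightarrow> real) \<Rightarrow> real \<Rightarrow> real" where
  "cdf a p x = interval_lebesgue_integral lborel a (ereal x) p"

definition kernK :: "ereal \<Rightarrow> (real \<Rightarrow> real) \<Rightarrow> real \<Rightarrow> real \<Rightarrow> real" where
  "kernK a p x y = cdf a p (min x y) * (1 - cdf a p (max x y))"

definition Ltil :: "ereal \<Rightarrow> ereal \<Rightarrow> (real \<Rightarrow> real) \<Rightarrow> (real \<Rightarrow> real) \<Rightarrow> (real \<Rightarrow> real) \<Rightarrow> real \<Rightarrow> real" where
  "Ltil a b p w f x = (1 / (p x * w x)) * (LINT y:oint a b|lborel. kernK a p x y * f y)"

definition E2 :: "ereal \<Rightarrow> ereal \<Rightarrow> (real \<Rightarrow> real) \<Rightarrow> (real \<Rightarrow> real) \<Rightarrow> real \<Rightarrow> (real \<Rightarrow> real) set" where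
  "E2 a b p w x0 = {f. L2w a b (\<lambda>x. p x * w x) f \<and> loc_int a b f \<and>
      L2w a b p (\<lambda>x. interval_lebesgue_integral lborel (ereal x0) (ereal x) f)}"

definition ess_sup_on :: "ereal \<Rightarrow> ereal \<Rightarrow> (real \<Rightarrow> real) \<Rightarrow> ereal" where
  "ess_sup_on a b f = Inf {z. AE x in lborel. x \<in> oint a b \<longrightarrow> ereal (f x) \<le> z}"

definition ess_inf_on :: "ereal \<Rightarrow> ereal \<Rightarrow> (real \<Rightarrow> real) \<Rightarrow> ereal" where
  "ess_inf_on a b f = Sup {z. AE x in lborel. x \<in> oint a b \<longrightarrow> z \<le> ereal (f x)}"

end

theory Submission
  imports Defs
begin

text \<open>
  By Hoeffding's formula, the variance of a primitive of \<open>f \<ge> 0\<close> is the quadratic form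
  \<open>B f = \<integral>\<integral> K(x,y) f(x) f(y)\<close>, so \<open>C\<close> is a Poincare constant iff \<open>B f \<le> C \<integral> f\<^sup>2 p w\<close>
  for all \<open>f \<ge> 0\<close>; sign changes of a derivative only decrease the variance because \<open>K \<ge> 0\<close>.
  For \<open>g > 0\<close>, an inequality \<open>L g \<le> M g\<close> makes \<open>M\<close> a Poincare constant by Schur's test, while
  \<open>m g \<le> L g\<close> gives \<open>m \<integral> g\<^sup>2 p w \<le> B g \<le> C \<integral> g\<^sup>2 p w\<close>, provided \<open>g\<close> is in \<open>L\<^sup>2(p w)\<close>. The operator
  preserves \<open>L\<^sup>2(p w)\<close> by the form bound, and, being positive, preserves both inequalities,
  which yields the nesting.
\<close>

section \<open>Symmetric positive kernels\<close>

text \<open>The main obstacle is that \<open>Ltil\<close> is a Bochner integral, which takes the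
  value 0 when its integrand is not integrable, and a finite norm of \<open>g\<close> does not
  visibly make the kernel times \<open>g\<close> integrable. All estimates are therefore made for
  \<open>kop\<close>, with values in \<open>ennreal\<close>, where Tonelli and monotone convergence
  hold unconditionally and infinite values are harmless. Finiteness of \<open>kop g\<close> almost
  everywhere is then a conclusion: it follows from the L2 bound on \<open>kop g / q\<close>, which
  the form bound forces. Only afterwards is \<open>Ltil\<close> identified with \<open>kop\<close>
  divided by the weight. No eigenfunction is used, so the optimal constant need not be attained.
  Functions \<open>h\<close> meet the form only through increments \<open>h y - h x\<close>:
  additive constants cancel, and a weakly differentiable \<open>h\<close> has to be compared with a
  primitive only on compact subintervals, with a separate constant on each. Conversely, the test
  functions are primitives of nonnegative functions cut off to compact subintervals; such primitives
  are bounded, and the cut-off is removed by monotone convergence.\<close>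

locale symmetric_kernel = sigma_finite_measure M for M :: "'a measure" +
  fixes K :: "'a \<Rightarrow> 'a \<Rightarrow> ennreal" and q :: "'a \<Rightarrow> real"
  assumes K_measurable[measurable]: "(\<lambda>(x, y). K x y) \<in> borel_measurable (M \<Otimes>\<^sub>M M)"
    and K_sym: "K x y = K y x"
    and q_measurable[measurable]: "q \<in> borel_measurable M"
    and q_pos: "AE x in M. 0 < q x"
begin

text \<open>\<open>ennreal\<close> sends negative numbers to 0, so \<open>kop\<close> and
  \<open>kform\<close> see only the positive part of their argument, whereas \<open>sqnorm\<close>
  squares first and sees both signs. A bound of \<open>kform f\<close> by \<open>sqnorm f\<close>
  therefore makes sense for signed \<open>f\<close> and is implied by its case
  \<open>f \<ge> 0\<close>.\<close>

definition kop :: "('a \<Rightarrow> real) \<Rightarrow> 'a \<Rightarrow> ennreal" where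
  "kop g x = (\<integral>\<^sup>+y. K x y * ennreal (g y) \<partial>M)"

definition kform :: "('a \<Rightarrow> real) \<Rightarrow> ennreal" where
  "kform f = (\<integral>\<^sup>+x. ennreal (f x) * kop f x \<partial>M)"

definition sqnorm :: "('a \<Rightarrow> real) \<Rightarrow> ennreal" where
  "sqnorm f = (\<integral>\<^sup>+x. ennreal ((f x)\<^sup>2 * q x) \<partial>M)"

lemma kop_measurable[measurable]:
  assumes [measurable]: "g \<in> borel_measurable M"
  shows "kop g \<in> borel_measurable M"
  unfolding kop_def[abs_def] by measurable

lemma kop_mono_AE:
  assumes "AE y in M. f y \<le> g y"
  shows "kop f x \<le> kop g x"
  unfolding kop_def
  by (rule nn_integral_mono_AE, use assms in eventually_elim) (auto intro!: mult_left_mono ennreal_leI)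

lemma kop_cmult:
  assumes [measurable]: "g \<in> borel_measurable M" and x: "x \<in> space M" and c: "0 \<le> c"
  shows "kop (\<lambda>y. c * g y) x = ennreal c * kop g x"
proof -
  have "kop (\<lambda>y. c * g y) x = (\<integral>\<^sup>+y. ennreal c * (K x y * ennreal (g y)) \<partial>M)"
    unfolding kop_def using c by (intro nn_integral_cong) (simp add: ennreal_mult' ac_simps)
  also have "\<dots> = ennreal c * kop g x"
    unfolding kop_def using x by (intro nn_integral_cmult) measurable
  finally show ?thesis .
qed

lemma kop_add:
  assumes [measurable]: "f \<in> borel_measurable M" "g \<in> borel_measurable M" and x: "x \<in> space M"
    and "AE y in M. 0 \<le> f y" "AE y in M. 0 \<le> g y"
  shows "kop (\<lambda>y. f y + g y) x = kop f x + kop g x"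
proof -
  have "kop (\<lambda>y. f y + g y) x = (\<integral>\<^sup>+y. K x y * ennreal (f y) + K x y * ennreal (g y) \<partial>M)"
    unfolding kop_def
    by (rule nn_integral_cong_AE, use assms(4,5) in eventually_elim) (simp add: distrib_left)
  also have "\<dots> = kop f x + kop g x"
    unfolding kop_def using x by (intro nn_integral_add) measurable
  finally show ?thesis .
qed

lemma kop_symmetric:
  assumes [measurable]: "f \<in> borel_measurable M" "g \<in> borel_measurable M"
  shows "(\<integral>\<^sup>+x. ennreal (f x) * kop g x \<partial>M) = (\<integral>\<^sup>+x. ennreal (g x) * kop f x \<partial>M)"
proof -
  interpret pair_sigma_finite M M ..
  have "(\<integral>\<^sup>+x. ennreal (f x) * kop g x \<partial>M)
      = (\<integral>\<^sup>+x. \<integral>\<^sup>+y. K x y * ennreal (f x) * ennreal (g y) \<partial>M \<partial>M)"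
    unfolding kop_def
    by (intro nn_integral_cong, subst nn_integral_cmult[symmetric]) (simp_all add: ac_simps)
  also have "\<dots> = (\<integral>\<^sup>+y. \<integral>\<^sup>+x. K x y * ennreal (f x) * ennreal (g y) \<partial>M \<partial>M)"
    by (rule Fubini'[symmetric]) measurable
  also have "\<dots> = (\<integral>\<^sup>+x. ennreal (g x) * kop f x \<partial>M)"
    unfolding kop_def
    by (intro nn_integral_cong, subst nn_integral_cmult[symmetric]) (simp_all add: ac_simps K_sym)
  finally show ?thesis .
qed

text \<open>Schur's test: the form is estimated by AM-GM with the weights \<open>g y / g x\<close>.\<close>

lemma kform_le_of_supersolution:
  assumes [measurable]: "f \<in> borel_measurable M" "g \<in> borel_measurable M"
    and g: "AE x in M. 0 < g x" and c: "0 \<le> c"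
    and le: "AE x in M. kop g x \<le> ennreal (c * g x * q x)"
  shows "kform f \<le> ennreal c * sqnorm f"
proof -
  interpret pair_sigma_finite M M ..
  let ?G = "\<lambda>x y. K x y * ennreal ((f x)\<^sup>2 / g x) * ennreal (g y)"
  let ?S = "\<integral>\<^sup>+x. \<integral>\<^sup>+y. ?G x y \<partial>M \<partial>M"
  have amgm: "2 * (a * b) \<le> a\<^sup>2 / r * s + b\<^sup>2 / s * r" if "0 < r" "0 < s" for a b r s :: real
  proof -
    have "a\<^sup>2 / r * s + b\<^sup>2 / s * r - 2 * (a * b) = (a * s - b * r)\<^sup>2 / (r * s)"
      using that by (simp add: field_simps power2_eq_square)
    also have "\<dots> \<ge> 0" using that by simp
    finally show ?thesis by simp
  qed
  \<comment> \<open>The form is doubled because AM-GM produces two terms that are exchanged by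
    swapping \<open>x\<close> and \<open>y\<close>. Tonelli makes their integrals equal, and the
    factor 2 cancels in \<open>ennreal\<close> even when both sides are infinite.\<close>
  have "2 * kform f = (\<integral>\<^sup>+x. \<integral>\<^sup>+y. 2 * (K x y * ennreal (f x) * ennreal (f y)) \<partial>M \<partial>M)"
    unfolding kform_def kop_def
    by (subst nn_integral_cmult[symmetric], measurable,
        intro nn_integral_cong, subst nn_integral_cmult[symmetric], simp,
        subst nn_integral_cmult[symmetric], simp_all add: ac_simps)
  also have "\<dots> \<le> (\<integral>\<^sup>+x. \<integral>\<^sup>+y. ?G x y + ?G y x \<partial>M \<partial>M)"
  proof (rule nn_integral_mono_AE, use g in eventually_elim)
    fix x assume x: "0 < g x"
    show "(\<integral>\<^sup>+y. 2 * (K x y * ennreal (f x) * ennreal (f y)) \<partial>M) \<le> (\<integral>\<^sup>+y. ?G x y + ?G y x \<partial>M)"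
    proof (rule nn_integral_mono_AE, use g in eventually_elim)
      fix y assume y: "0 < g y"
      have "2 * (ennreal (f x) * ennreal (f y)) \<le>
          ennreal ((f x)\<^sup>2 / g x) * ennreal (g y) + ennreal ((f y)\<^sup>2 / g y) * ennreal (g x)"
      proof (cases "0 \<le> f x \<and> 0 \<le> f y")
        case True
        have "2 * (ennreal (f x) * ennreal (f y)) = ennreal (2 * (f x * f y))"
          using True by (simp add: ennreal_mult)
        also have "\<dots> \<le> ennreal ((f x)\<^sup>2 / g x * g y + (f y)\<^sup>2 / g y * g x)"
          using amgm[OF x y] by (rule ennreal_leI)
        also have "\<dots> = ennreal ((f x)\<^sup>2 / g x) * ennreal (g y) + ennreal ((f y)\<^sup>2 / g y) * ennreal (g x)"
          using x y by (simp flip: ennreal_mult)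
        finally show ?thesis .
      next
        case False
        then show ?thesis by (auto simp: ennreal_neg)
      qed
      then have "K x y * (2 * (ennreal (f x) * ennreal (f y))) \<le> K x y * (
          ennreal ((f x)\<^sup>2 / g x) * ennreal (g y) + ennreal ((f y)\<^sup>2 / g y) * ennreal (g x))"
        by (rule mult_left_mono) simp
      then show "2 * (K x y * ennreal (f x) * ennreal (f y)) \<le> ?G x y + ?G y x"
        using K_sym[of y x] by (simp add: distrib_left ac_simps)
    qed
  qed
  also have "\<dots> = (\<integral>\<^sup>+x. (\<integral>\<^sup>+y. ?G x y \<partial>M) + (\<integral>\<^sup>+y. ?G y x \<partial>M) \<partial>M)"
    by (intro nn_integral_cong nn_integral_add) measurable
  also have "\<dots> = ?S + (\<integral>\<^sup>+x. \<integral>\<^sup>+y. ?G y x \<partial>M \<partial>M)"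
    by (intro nn_integral_add) measurable
  also have "(\<integral>\<^sup>+x. \<integral>\<^sup>+y. ?G y x \<partial>M \<partial>M) = ?S"
    by (rule Fubini') measurable
  also have "?S = (\<integral>\<^sup>+x. ennreal ((f x)\<^sup>2 / g x) * kop g x \<partial>M)"
    unfolding kop_def
    by (intro nn_integral_cong, subst nn_integral_cmult[symmetric]) (simp_all add: ac_simps)
  finally have "2 * kform f \<le> 2 * (\<integral>\<^sup>+x. ennreal ((f x)\<^sup>2 / g x) * kop g x \<partial>M)"
    by (simp add: mult_2)
  then have "kform f \<le> (\<integral>\<^sup>+x. ennreal ((f x)\<^sup>2 / g x) * kop g x \<partial>M)"
    by (simp add: ennreal_mult_le_mult_iff)
  also have "\<dots> \<le> (\<integral>\<^sup>+x. ennreal c * ennreal ((f x)\<^sup>2 * q x) \<partial>M)"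
  proof (rule nn_integral_mono_AE, use g le q_pos in eventually_elim)
    fix x assume x: "0 < g x" "kop g x \<le> ennreal (c * g x * q x)" "0 < q x"
    have "ennreal ((f x)\<^sup>2 / g x) * kop g x \<le> ennreal ((f x)\<^sup>2 / g x) * ennreal (c * g x * q x)"
      using x by (intro mult_left_mono) auto
    also have "\<dots> = ennreal ((f x)\<^sup>2 / g x * (c * g x * q x))"
      using x by (intro ennreal_mult'[symmetric]) simp
    also have "(f x)\<^sup>2 / g x * (c * g x * q x) = c * ((f x)\<^sup>2 * q x)"
      using x by (simp add: field_simps)
    finally show "ennreal ((f x)\<^sup>2 / g x) * kop g x \<le> ennreal c * ennreal ((f x)\<^sup>2 * q x)"
      using c by (simp add: ennreal_mult')
  qed
  also have "\<dots> = ennreal c * sqnorm f"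
    unfolding sqnorm_def by (intro nn_integral_cmult) measurable
  finally show ?thesis .
qed

text \<open>Expanding the form at \<open>s * u + g\<close> and dropping the two diagonal terms
  leaves twice the mixed term. This replaces the Cauchy-Schwarz inequality for the bilinear form,
  which would require positive semidefiniteness on signed functions; here only pointwise
  nonnegativity of the kernel enters. The free scale \<open>s\<close> allows \<open>sqnorm u\<close>
  to be absorbed later.\<close>

lemma kop_form_le:
  assumes [measurable]: "u \<in> borel_measurable M" "g \<in> borel_measurable M"
    and u: "AE x in M. 0 \<le> u x" and g: "AE x in M. 0 \<le> g x"
    and c: "0 \<le> c" and s: "0 \<le> s"
    and bound: "\<And>f. f \<in> borel_measurable M \<Longrightarrow> sqnorm f < \<infinity> \<Longrightarrow> kform f \<le> ennreal c * sqnorm f"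
    and fin: "sqnorm u < \<infinity>" "sqnorm g < \<infinity>"
  shows "2 * (ennreal s * (\<integral>\<^sup>+x. ennreal (u x) * kop g x \<partial>M))
    \<le> ennreal c * (ennreal (2 * s\<^sup>2) * sqnorm u + 2 * sqnorm g)"
proof -
  let ?f = "\<lambda>x. s * u x + g x"
  let ?I = "\<integral>\<^sup>+x. ennreal (u x) * kop g x \<partial>M"
  have kop_f: "kop ?f x = ennreal s * kop u x + kop g x" if "x \<in> space M" for x
    using that u g s by (subst kop_add) (auto simp: kop_cmult elim: eventually_mono)
  \<comment> \<open>This is the parallelogram identity with the square of \<open>s * u - g\<close>
    discarded.\<close>
  have N: "sqnorm ?f \<le> ennreal (2 * s\<^sup>2) * sqnorm u + 2 * sqnorm g"
  proof -
    have "sqnorm ?f \<le> (\<integral>\<^sup>+x. ennreal (2 * s\<^sup>2) * ennreal ((u x)\<^sup>2 * q x) + 2 * ennreal ((g x)\<^sup>2 * q x) \<partial>M)"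
      unfolding sqnorm_def
    proof (rule nn_integral_mono_AE, use q_pos in eventually_elim)
      fix x assume "0 < q x"
      have "2 * s\<^sup>2 * (u x)\<^sup>2 + 2 * (g x)\<^sup>2 - (?f x)\<^sup>2 = (s * u x - g x)\<^sup>2"
        by (simp add: power2_eq_square algebra_simps)
      then have "(?f x)\<^sup>2 \<le> 2 * s\<^sup>2 * (u x)\<^sup>2 + 2 * (g x)\<^sup>2"
        by (metis diff_ge_0_iff_ge zero_le_power2)
      then have "(?f x)\<^sup>2 * q x \<le> (2 * s\<^sup>2 * (u x)\<^sup>2 + 2 * (g x)\<^sup>2) * q x"
        using \<open>0 < q x\<close> by (intro mult_right_mono) auto
      also have "\<dots> = 2 * s\<^sup>2 * ((u x)\<^sup>2 * q x) + 2 * ((g x)\<^sup>2 * q x)"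
        by (simp add: algebra_simps)
      finally have "ennreal ((?f x)\<^sup>2 * q x) \<le> ennreal (2 * s\<^sup>2 * ((u x)\<^sup>2 * q x) + 2 * ((g x)\<^sup>2 * q x))"
        by (rule ennreal_leI)
      also have "\<dots> = ennreal (2 * s\<^sup>2 * ((u x)\<^sup>2 * q x)) + ennreal (2 * ((g x)\<^sup>2 * q x))"
        using \<open>0 < q x\<close> by (intro ennreal_plus) auto
      also have "\<dots> = ennreal (2 * s\<^sup>2) * ennreal ((u x)\<^sup>2 * q x) + 2 * ennreal ((g x)\<^sup>2 * q x)"
        using \<open>0 < q x\<close> ennreal_mult[of "2 * s\<^sup>2" "(u x)\<^sup>2 * q x"] ennreal_mult[of 2 "(g x)\<^sup>2 * q x"] by simp
      finally show "ennreal ((?f x)\<^sup>2 * q x) \<le> ennreal (2 * s\<^sup>2) * ennreal ((u x)\<^sup>2 * q x) + 2 * ennreal ((g x)\<^sup>2 * q x)" .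
    qed
    also have "\<dots> = ennreal (2 * s\<^sup>2) * sqnorm u + 2 * sqnorm g"
      unfolding sqnorm_def by (simp add: nn_integral_add nn_integral_cmult)
    finally show ?thesis .
  qed
  \<comment> \<open>By symmetry of the kernel, the two mixed terms of the expanded form have the
    same integral; one copy is rewritten with \<open>u\<close> and \<open>g\<close>
    exchanged.\<close>
  have "2 * (ennreal s * ?I) = (\<integral>\<^sup>+x. ennreal s * (ennreal (u x) * kop g x) \<partial>M)
      + (\<integral>\<^sup>+x. ennreal s * (ennreal (g x) * kop u x) \<partial>M)"
    by (simp add: nn_integral_cmult kop_symmetric[of g u] mult_2)
  also have "\<dots> = (\<integral>\<^sup>+x. ennreal s * (ennreal (u x) * kop g x) + ennreal s * (ennreal (g x) * kop u x) \<partial>M)"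
    by (intro nn_integral_add[symmetric]) measurable
  also have "\<dots> \<le> kform ?f"
    unfolding kform_def
  proof (rule nn_integral_mono_AE, use u g AE_space in eventually_elim)
    fix x assume x: "0 \<le> u x" "0 \<le> g x" "x \<in> space M"
    have "ennreal (?f x) * kop ?f x
        = (ennreal s * ennreal (u x) + ennreal (g x)) * (ennreal s * kop u x + kop g x)"
      using x s by (simp add: kop_f ennreal_mult)
    also have "\<dots> = ennreal s * (ennreal (u x) * kop g x) + ennreal s * (ennreal (g x) * kop u x)
        + (ennreal s * ennreal (u x) * (ennreal s * kop u x) + ennreal (g x) * kop g x)"
      by (simp add: distrib_left distrib_right ac_simps)
    finally show "ennreal s * (ennreal (u x) * kop g x) + ennreal s * (ennreal (g x) * kop u x)
        \<le> ennreal (?f x) * kop ?f x"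
      by simp
  qed
  also have "\<dots> \<le> ennreal c * sqnorm ?f"
  proof (rule bound)
    show "sqnorm ?f < \<infinity>"
      using fin by (intro le_less_trans[OF N]) (simp add: ennreal_mult_less_top)
  qed measurable
  also have "\<dots> \<le> ennreal c * (ennreal (2 * s\<^sup>2) * sqnorm u + 2 * sqnorm g)"
    using N by (rule mult_left_mono) simp
  finally show ?thesis .
qed

text \<open>The truncations \<open>u = min (kop g / q) (k * g)\<close> have finite norm and satisfy
  \<open>sqnorm u \<le> \<integral> u * kop g\<close>; the right-hand side is absorbed by the form bound applied to \<open>s * u + g\<close>.\<close>

lemma kop_square_integrable:
  assumes [measurable]: "g \<in> borel_measurable M" and g: "AE x in M. 0 < g x"
    and c: "0 < c"
    and bound: "\<And>f. f \<in> borel_measurable M \<Longrightarrow> sqnorm f < \<infinity> \<Longrightarrow> kform f \<le> ennreal c * sqnorm f"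
    and fin: "sqnorm g < \<infinity>"
  shows "(\<integral>\<^sup>+x. (kop g x / ennreal (q x))\<^sup>2 * ennreal (q x) \<partial>M) < \<infinity>"
proof -
  define A where "A x = kop g x / ennreal (q x)" for x
  have [measurable]: "A \<in> borel_measurable M" unfolding A_def[abs_def] by measurable
  \<comment> \<open>The cap \<open>k * g\<close> guarantees a finite norm before anything is known
    about \<open>A\<close>, which may still be infinite; \<open>enn2real\<close> loses nothing
    because the minimum is finite.\<close>
  define u where "u k x = enn2real (min (A x) (ennreal (real k * g x)))" for k :: nat and x
  have [measurable]: "u k \<in> borel_measurable M" for k unfolding u_def[abs_def] by measurable
  have u: "ennreal (u k x) = min (A x) (ennreal (real k * g x))" for k x
    unfolding u_def by (simp add: min_less_iff_disj)
  have u_nonneg: "0 \<le> u k x" for k x by (simp add: u_def)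
  define ng where "ng = enn2real (sqnorm g)"
  have ng: "sqnorm g = ennreal ng" "0 \<le> ng"
    using fin by (auto simp: ng_def)
  have sqnorm_u: "sqnorm (u k) \<le> ennreal (4 * c\<^sup>2 * ng)" for k
  proof -
    have "sqnorm (u k) \<le> (\<integral>\<^sup>+x. ennreal ((real k)\<^sup>2) * ennreal ((g x)\<^sup>2 * q x) \<partial>M)"
      unfolding sqnorm_def
    proof (rule nn_integral_mono_AE, use g q_pos in eventually_elim)
      fix x assume x: "0 < g x" "0 < q x"
      have "ennreal (u k x) \<le> ennreal (real k * g x)" by (simp add: u)
      then have "u k x \<le> real k * g x" using x by (subst (asm) ennreal_le_iff) auto
      then have "(u k x)\<^sup>2 \<le> (real k * g x)\<^sup>2" using u_nonneg by (intro power_mono) auto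
      then have "(u k x)\<^sup>2 * q x \<le> (real k)\<^sup>2 * ((g x)\<^sup>2 * q x)"
        using x by (simp add: power_mult_distrib)
      then show "ennreal ((u k x)\<^sup>2 * q x) \<le> ennreal ((real k)\<^sup>2) * ennreal ((g x)\<^sup>2 * q x)"
        using x by (subst ennreal_mult'[symmetric]) (auto intro: ennreal_leI)
    qed
    also have "\<dots> = ennreal ((real k)\<^sup>2) * sqnorm g"
      unfolding sqnorm_def by (intro nn_integral_cmult) measurable
    also have "\<dots> < \<infinity>" using ng by (simp add: ennreal_mult_less_top)
    finally have fin_u: "sqnorm (u k) < \<infinity>" .
    define nu where "nu = enn2real (sqnorm (u k))"
    have nu: "sqnorm (u k) = ennreal nu" "0 \<le> nu"
      using fin_u by (auto simp: nu_def)
    have "sqnorm (u k) \<le> (\<integral>\<^sup>+x. ennreal (u k x) * kop g x \<partial>M)"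
      unfolding sqnorm_def
    proof (rule nn_integral_mono_AE, use q_pos in eventually_elim)
      fix x assume x: "0 < q x"
      have "ennreal (u k x) * ennreal (q x) \<le> A x * ennreal (q x)"
        by (intro mult_right_mono) (auto simp: u)
      also have "\<dots> = kop g x"
        unfolding A_def using x by (simp add: ennreal_divide_times ennreal_divide_self)
      finally have "ennreal (u k x) * (ennreal (u k x) * ennreal (q x)) \<le> ennreal (u k x) * kop g x"
        by (intro mult_left_mono) auto
      then show "ennreal ((u k x)\<^sup>2 * q x) \<le> ennreal (u k x) * kop g x"
        using x u_nonneg by (simp add: power2_eq_square ennreal_mult' mult.assoc)
    qed
    \<comment> \<open>With \<open>s = 1 / (2 * c)\<close> the inequality reads
      \<open>nu / c \<le> nu / (2 * c) + 2 * c * ng\<close>. Half of the left side survives the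
      absorption, and the resulting bound \<open>4 * c\<^sup>2 * ng\<close> does not depend on
      \<open>k\<close>. Subtracting is legitimate because \<open>nu\<close> is a real
      number.\<close>
    then have "2 * (ennreal (1 / (2 * c)) * sqnorm (u k)) \<le> 2 * (ennreal (1 / (2 * c)) * (\<integral>\<^sup>+x. ennreal (u k x) * kop g x \<partial>M))"
      by (intro mult_left_mono) auto
    also have "\<dots> \<le> ennreal c * (ennreal (2 * (1 / (2 * c))\<^sup>2) * sqnorm (u k) + 2 * sqnorm g)"
      using u_nonneg g c bound fin_u fin
      by (intro kop_form_le) (auto elim: eventually_mono)
    also have "\<dots> = ennreal (c * (2 * (1 / (2 * c))\<^sup>2 * nu + 2 * ng))"
      using c nu(2) ng(2) unfolding nu(1) ng(1)
      by (simp add: ennreal_mult ennreal_plus)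
    also have "2 * (ennreal (1 / (2 * c)) * sqnorm (u k)) = ennreal (2 * (1 / (2 * c) * nu))"
      using c nu(2) unfolding nu(1) by (subst ennreal_mult, simp, simp, subst ennreal_mult) auto
    finally have "2 * (1 / (2 * c) * nu) \<le> c * (2 * (1 / (2 * c))\<^sup>2 * nu + 2 * ng)"
      using c nu(2) ng(2) by (subst (asm) ennreal_le_iff) auto
    then have "nu \<le> 4 * c\<^sup>2 * ng"
      using c by (simp add: field_simps power2_eq_square)
    then show ?thesis unfolding nu(1) by (rule ennreal_leI)
  qed
  have "(\<integral>\<^sup>+x. (A x)\<^sup>2 * ennreal (q x) \<partial>M) \<le> (\<integral>\<^sup>+x. (SUP k. ennreal ((u k x)\<^sup>2 * q x)) \<partial>M)"
  proof (rule nn_integral_mono_AE, use g q_pos in eventually_elim)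
    fix x assume x: "0 < g x" "0 < q x"
    have eq: "ennreal ((u k x)\<^sup>2 * q x) = (min (A x) (ennreal (real k * g x)))\<^sup>2 * ennreal (q x)" for k
      using x u_nonneg[of k x] unfolding u[symmetric] by (simp add: ennreal_mult' ennreal_power)
    show "(A x)\<^sup>2 * ennreal (q x) \<le> (SUP k. ennreal ((u k x)\<^sup>2 * q x))"
    proof (cases "A x = \<infinity>")
      case False
      then obtain r where r: "A x = ennreal r" "0 \<le> r" by (cases "A x") auto
      obtain k :: nat where "r / g x \<le> real k" using real_arch_simple by blast
      then have "r \<le> real k * g x" using x by (simp add: field_simps)
      then have "(A x)\<^sup>2 * ennreal (q x) \<le> ennreal ((u k x)\<^sup>2 * q x)"
        by (simp add: eq r(1) min_absorb1 ennreal_leI)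
      then show ?thesis by (rule SUP_upper2[rotated]) simp
    next
      \<comment> \<open>Points with \<open>kop g x = \<infinity>\<close> are not yet excluded. There
        \<open>u k x = k * g x\<close>, so the squares are unbounded in \<open>k\<close> and the
        supremum is infinite as well.\<close>
      case True
      have "ennreal (real n) \<le> (SUP k. ennreal ((u k x)\<^sup>2 * q x))" for n
      proof -
        obtain k :: nat where k: "real n / ((g x)\<^sup>2 * q x) \<le> real k" using real_arch_simple by blast
        have "real k \<le> (real k)\<^sup>2"
          by (metis of_nat_power of_nat_le_iff le_square power2_eq_square)
        with k have "real n / ((g x)\<^sup>2 * q x) \<le> (real k)\<^sup>2" by linarith
        then have "real n \<le> (real k * g x)\<^sup>2 * q x"
          using x by (simp add: field_simps power_mult_distrib)
        then have "ennreal (real n) \<le> ennreal ((u k x)\<^sup>2 * q x)"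
          using x True by (simp add: u_def ennreal_leI)
        then show ?thesis by (rule SUP_upper2[rotated]) simp
      qed
      then have "(SUP n. of_nat n :: ennreal) \<le> (SUP k. ennreal ((u k x)\<^sup>2 * q x))"
        by (intro SUP_least) (simp add: ennreal_of_nat_eq_real_of_nat)
      then show ?thesis unfolding ennreal_SUP_of_nat_eq_top by (rule order_trans[OF top_greatest])
    qed
  qed
  also have "\<dots> = (SUP k. sqnorm (u k))"
    unfolding sqnorm_def
  proof (rule nn_integral_monotone_convergence_SUP_AE)
    fix k
    show "AE x in M. ennreal ((u k x)\<^sup>2 * q x) \<le> ennreal ((u (Suc k) x)\<^sup>2 * q x)"
      using g q_pos
    proof eventually_elim
      fix x assume x: "0 < g x" "0 < q x"
      have "ennreal (u k x) \<le> ennreal (u (Suc k) x)"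
        unfolding u using x by (intro min.mono ennreal_leI mult_right_mono) auto
      then have "(u k x)\<^sup>2 \<le> (u (Suc k) x)\<^sup>2"
        using u_nonneg by (intro power_mono) (auto simp: ennreal_le_iff)
      then show "ennreal ((u k x)\<^sup>2 * q x) \<le> ennreal ((u (Suc k) x)\<^sup>2 * q x)"
        using x by (intro ennreal_leI mult_right_mono) auto
    qed
  qed measurable
  also have "\<dots> \<le> ennreal (4 * c\<^sup>2 * ng)"
    using sqnorm_u by (intro SUP_least)
  also have "\<dots> < \<infinity>" by simp
  finally show ?thesis unfolding A_def .
qed

text \<open>Monotone convergence is applied twice, inside \<open>kop\<close> and in the outer
  integral. Agreement with \<open>f\<close> is demanded only after \<open>ennreal\<close>, so that
  the \<open>F k\<close> may be cut-offs of the positive part of a signed \<open>f\<close>.\<close>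

lemma kform_le_of_exhaustion:
  assumes [measurable]: "\<And>k. F k \<in> borel_measurable M" "f \<in> borel_measurable M"
    and mono: "\<And>x. incseq (\<lambda>k. F k x)"
    and ev: "AE x in M. \<exists>j. \<forall>k\<ge>j. ennreal (F k x) = ennreal (f x)"
    and le: "\<And>k::nat. kform (F k) \<le> C"
  shows "kform f \<le> C"
proof -
  have kop_mono: "kop (F i) x \<le> kop (F j) x" if "i \<le> j" for i j x
    using mono that by (intro kop_mono_AE) (auto simp: incseq_def)
  have F_mono: "ennreal (F i x) \<le> ennreal (F j x)" if "i \<le> j" for i j x
    using mono that by (intro ennreal_leI) (auto simp: incseq_def)
  have kop_le: "kop f x \<le> (SUP k. kop (F k) x)" if x: "x \<in> space M" for x
  proof -
    have "kop f x \<le> (\<integral>\<^sup>+y. (SUP k. K x y * ennreal (F k y)) \<partial>M)"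
      unfolding kop_def
    proof (rule nn_integral_mono_AE, use ev in eventually_elim)
      fix y assume "\<exists>j. \<forall>k\<ge>j. ennreal (F k y) = ennreal (f y)"
      then obtain j where "ennreal (F j y) = ennreal (f y)" by blast
      then show "K x y * ennreal (f y) \<le> (SUP k. K x y * ennreal (F k y))"
        by (intro SUP_upper2[of j]) auto
    qed
    also have "\<dots> = (SUP k. kop (F k) x)"
      unfolding kop_def
      using x F_mono by (intro nn_integral_monotone_convergence_SUP) (auto simp: incseq_def le_fun_def intro!: mult_left_mono)
    finally show ?thesis .
  qed
  have "kform f \<le> (\<integral>\<^sup>+x. (SUP k. ennreal (F k x) * kop (F k) x) \<partial>M)"
    unfolding kform_def
  proof (rule nn_integral_mono_AE, use ev AE_space in eventually_elim)
    fix x assume "\<exists>j. \<forall>k\<ge>j. ennreal (F k x) = ennreal (f x)" and x: "x \<in> space M"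
    then obtain j where j: "\<And>k. j \<le> k \<Longrightarrow> ennreal (F k x) = ennreal (f x)" by blast
    have "ennreal (f x) * kop f x \<le> ennreal (f x) * (SUP k. kop (F k) x)"
      using kop_le[OF x] by (rule mult_left_mono) simp
    also have "\<dots> = (SUP k. ennreal (f x) * kop (F k) x)"
      by (simp add: SUP_mult_left_ennreal)
    \<comment> \<open>The outer factor stabilises from index \<open>j\<close> on, while the inner
      supremum runs over \<open>k\<close>; the index \<open>max j k\<close> serves both.\<close>
    also have "\<dots> \<le> (SUP k. ennreal (F k x) * kop (F k) x)"
    proof (rule SUP_mono)
      fix k
      have "ennreal (f x) * kop (F k) x \<le> ennreal (F (max j k) x) * kop (F (max j k)) x"
        using j[of "max j k"] kop_mono[of k "max j k" x] by (auto intro: mult_left_mono)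
      then show "\<exists>m\<in>UNIV. ennreal (f x) * kop (F k) x \<le> ennreal (F m x) * kop (F m) x" by blast
    qed
    finally show "ennreal (f x) * kop f x \<le> (SUP k. ennreal (F k x) * kop (F k) x)" .
  qed
  also have "\<dots> = (SUP k. kform (F k))"
    unfolding kform_def
    using F_mono kop_mono
    by (intro nn_integral_monotone_convergence_SUP) (auto simp: incseq_def le_fun_def intro!: mult_mono)
  also have "\<dots> \<le> C" using le by (rule SUP_least)
  finally show ?thesis .
qed

end

section \<open>Variance and increments\<close>

text \<open>The variance is half the mean squared difference of two independent copies. The diagonal
  contributes nothing, and restricting to \<open>x < y\<close> accounts for the factor one half.
  Ordered pairs are what allows a difference to be written as an integral over the window between
  the points.\<close>

lemma variance_eq_nn_integral_pairs:
  fixes M :: "real measure" and h :: "real \<Rightarrow> real"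
  assumes sets[measurable_cong]: "sets M = sets borel" and one: "emeasure M (space M) = 1"
    and [measurable]: "h \<in> borel_measurable M" and h2: "integrable M (\<lambda>x. (h x)\<^sup>2)"
  shows "ennreal ((\<integral>x. (h x)\<^sup>2 \<partial>M) - (\<integral>x. h x \<partial>M)\<^sup>2)
    = (\<integral>\<^sup>+x. \<integral>\<^sup>+y. (if x < y then ennreal ((h y - h x)\<^sup>2) else 0) \<partial>M \<partial>M)"
proof -
  interpret finite_measure M by (rule finite_measureI) (simp add: one)
  interpret pair_sigma_finite M M ..
  have h1: "integrable M h" by (rule square_integrable_imp_integrable[OF _ h2]) measurable
  define m1 where "m1 = (\<integral>x. h x \<partial>M)"
  define m2 where "m2 = (\<integral>x. (h x)\<^sup>2 \<partial>M)"
  have one': "measure M (space M) = 1" using one by (simp add: measure_def)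
  have inner: "(\<integral>\<^sup>+y. ennreal ((h y - h x)\<^sup>2) \<partial>M) = ennreal (m2 - 2 * h x * m1 + (h x)\<^sup>2)" for x
  proof -
    have sq: "(\<lambda>y. (h y - h x)\<^sup>2) = (\<lambda>y. (h y)\<^sup>2 - (2 * h x) * h y + (h x)\<^sup>2)"
      by (simp add: fun_eq_iff power2_eq_square algebra_simps)
    have "integrable M (\<lambda>y. (h y - h x)\<^sup>2)"
      unfolding sq using h1 h2 by (intro Bochner_Integration.integrable_add Bochner_Integration.integrable_diff) auto
    then have "(\<integral>\<^sup>+y. ennreal ((h y - h x)\<^sup>2) \<partial>M) = ennreal (\<integral>y. (h y - h x)\<^sup>2 \<partial>M)"
      by (intro nn_integral_eq_integral) auto
    also have "(\<integral>y. (h y - h x)\<^sup>2 \<partial>M) = m2 - 2 * h x * m1 + (h x)\<^sup>2"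
      unfolding sq m1_def m2_def using h1 h2 one' by simp
    finally show ?thesis .
  qed
  have "(\<integral>\<^sup>+x. \<integral>\<^sup>+y. ennreal ((h y - h x)\<^sup>2) \<partial>M \<partial>M)
      = (\<integral>\<^sup>+x. ennreal (m2 - (2 * m1) * h x + (h x)\<^sup>2) \<partial>M)"
    by (simp add: inner ac_simps)
  also have "\<dots> = ennreal (\<integral>x. m2 - (2 * m1) * h x + (h x)\<^sup>2 \<partial>M)"
  proof (intro nn_integral_eq_integral AE_I2)
    fix x
    \<comment> \<open>Nonnegativity of the variance, together with completing the square in
      \<open>h x\<close>, makes the integrand nonnegative, so that the extended integral equals the
      real one.\<close>
    have "m1\<^sup>2 \<le> m2"
    proof -
      have "0 \<le> (\<integral>y. (h y - m1)\<^sup>2 \<partial>M)" by simp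
      also have "(\<lambda>y. (h y - m1)\<^sup>2) = (\<lambda>y. (h y)\<^sup>2 - (2 * m1) * h y + m1\<^sup>2)"
        by (simp add: fun_eq_iff power2_eq_square algebra_simps)
      also have "(\<integral>y. (h y)\<^sup>2 - (2 * m1) * h y + m1\<^sup>2 \<partial>M) = m2 - 2 * m1 * m1 + m1\<^sup>2"
        using h1 h2 one' unfolding m1_def m2_def by simp
      finally show ?thesis by (simp add: power2_eq_square)
    qed
    moreover have "m2 - 2 * m1 * h x + (h x)\<^sup>2 = (m2 - m1\<^sup>2) + (h x - m1)\<^sup>2"
      by (simp add: power2_eq_square algebra_simps)
    ultimately show "0 \<le> m2 - 2 * m1 * h x + (h x)\<^sup>2"
      by (metis add_nonneg_nonneg diff_ge_0_iff_ge zero_le_power2)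
  qed (intro Bochner_Integration.integrable_add Bochner_Integration.integrable_diff
      integrable_mult_right integrable_const h1 h2)
  also have "(\<integral>x. m2 - (2 * m1) * h x + (h x)\<^sup>2 \<partial>M) = 2 * (m2 - m1\<^sup>2)"
    using h1 h2 one' unfolding m1_def m2_def by (simp add: power2_eq_square)
  finally have total: "(\<integral>\<^sup>+x. \<integral>\<^sup>+y. ennreal ((h y - h x)\<^sup>2) \<partial>M \<partial>M) = 2 * ennreal (m2 - m1\<^sup>2)"
    using ennreal_mult'[of 2 "m2 - m1\<^sup>2"] by simp
  let ?F = "\<lambda>x y. if x < y then ennreal ((h y - h x)\<^sup>2) else 0"
  have F[measurable]: "(\<lambda>(x, y). ?F x y) \<in> borel_measurable (M \<Otimes>\<^sub>M M)"
    by measurable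
  have "(\<integral>\<^sup>+x. \<integral>\<^sup>+y. ennreal ((h y - h x)\<^sup>2) \<partial>M \<partial>M) = (\<integral>\<^sup>+x. \<integral>\<^sup>+y. ?F x y + ?F y x \<partial>M \<partial>M)"
  proof (intro nn_integral_cong)
    fix x y
    show "ennreal ((h y - h x)\<^sup>2) = ?F x y + ?F y x"
      by (cases x y rule: linorder_cases) (simp_all add: power2_commute[of "h x" "h y"])
  qed
  also have "\<dots> = (\<integral>\<^sup>+x. (\<integral>\<^sup>+y. ?F x y \<partial>M) + (\<integral>\<^sup>+y. ?F y x \<partial>M) \<partial>M)"
    by (intro nn_integral_cong nn_integral_add) measurable
  also have "\<dots> = (\<integral>\<^sup>+x. \<integral>\<^sup>+y. ?F x y \<partial>M \<partial>M) + (\<integral>\<^sup>+x. \<integral>\<^sup>+y. ?F y x \<partial>M \<partial>M)"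
    by (intro nn_integral_add) measurable
  also have "(\<integral>\<^sup>+x. \<integral>\<^sup>+y. ?F y x \<partial>M \<partial>M) = (\<integral>\<^sup>+x. \<integral>\<^sup>+y. ?F x y \<partial>M \<partial>M)"
    by (rule Fubini') measurable
  finally have "2 * (\<integral>\<^sup>+x. \<integral>\<^sup>+y. ?F x y \<partial>M \<partial>M) = 2 * ennreal (m2 - m1\<^sup>2)"
    using total by (simp add: mult_2)
  then have "(\<integral>\<^sup>+x. \<integral>\<^sup>+y. ?F x y \<partial>M \<partial>M) = ennreal (m2 - m1\<^sup>2)"
    by (subst (asm) ennreal_mult_cancel_left) auto
  then show ?thesis unfolding m1_def m2_def by simp
qed

text \<open>Hoeffding's covariance formula, for increments of a primitive.\<close>

lemma nn_integral_increment_square: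
  fixes \<mu> M :: "real measure" and f :: "real \<Rightarrow> ennreal"
  assumes "sigma_finite_measure \<mu>" "sigma_finite_measure M"
    and sets[measurable_cong]: "sets \<mu> = sets borel" "sets M = sets borel"
    and [measurable]: "f \<in> borel_measurable borel"
  shows "(\<integral>\<^sup>+x. \<integral>\<^sup>+y. (\<integral>\<^sup>+s. (if x \<le> s \<and> s < y then f s else 0) \<partial>M)\<^sup>2 \<partial>\<mu> \<partial>\<mu>)
    = (\<integral>\<^sup>+s. \<integral>\<^sup>+t. f s * f t * (emeasure \<mu> {..min s t} * emeasure \<mu> {max s t<..}) \<partial>M \<partial>M)"
proof -
  interpret mu: sigma_finite_measure \<mu> by fact
  interpret M: sigma_finite_measure M by fact
  interpret Mm: pair_sigma_finite M \<mu> ..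
  let ?F = "\<lambda>x y s. if x \<le> s \<and> s < y then f s else 0"
  have "(\<integral>\<^sup>+x. \<integral>\<^sup>+y. (\<integral>\<^sup>+s. ?F x y s \<partial>M)\<^sup>2 \<partial>\<mu> \<partial>\<mu>)
      = (\<integral>\<^sup>+x. \<integral>\<^sup>+y. \<integral>\<^sup>+s. \<integral>\<^sup>+t. ?F x y s * ?F x y t \<partial>M \<partial>M \<partial>\<mu> \<partial>\<mu>)"
  proof (intro nn_integral_cong)
    fix x y
    have "(\<integral>\<^sup>+s. \<integral>\<^sup>+t. ?F x y s * ?F x y t \<partial>M \<partial>M) = (\<integral>\<^sup>+s. ?F x y s * (\<integral>\<^sup>+t. ?F x y t \<partial>M) \<partial>M)"
      by (intro nn_integral_cong nn_integral_cmult) measurable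
    also have "\<dots> = (\<integral>\<^sup>+s. ?F x y s \<partial>M) * (\<integral>\<^sup>+t. ?F x y t \<partial>M)"
      by (intro nn_integral_multc) measurable
    finally show "(\<integral>\<^sup>+s. ?F x y s \<partial>M)\<^sup>2 = (\<integral>\<^sup>+s. \<integral>\<^sup>+t. ?F x y s * ?F x y t \<partial>M \<partial>M)"
      by (simp add: power2_eq_square)
  qed
  \<comment> \<open>Four Tonelli exchanges bring the order \<open>x, y, s, t\<close> into
    \<open>s, t, x, y\<close>.\<close>
  also have "\<dots> = (\<integral>\<^sup>+x. \<integral>\<^sup>+s. \<integral>\<^sup>+y. \<integral>\<^sup>+t. ?F x y s * ?F x y t \<partial>M \<partial>\<mu> \<partial>M \<partial>\<mu>)"
    by (intro nn_integral_cong Mm.Fubini') measurable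
  also have "\<dots> = (\<integral>\<^sup>+s. \<integral>\<^sup>+x. \<integral>\<^sup>+y. \<integral>\<^sup>+t. ?F x y s * ?F x y t \<partial>M \<partial>\<mu> \<partial>\<mu> \<partial>M)"
    by (rule Mm.Fubini') measurable
  also have "\<dots> = (\<integral>\<^sup>+s. \<integral>\<^sup>+x. \<integral>\<^sup>+t. \<integral>\<^sup>+y. ?F x y s * ?F x y t \<partial>\<mu> \<partial>M \<partial>\<mu> \<partial>M)"
    by (intro nn_integral_cong Mm.Fubini') measurable
  also have "\<dots> = (\<integral>\<^sup>+s. \<integral>\<^sup>+t. \<integral>\<^sup>+x. \<integral>\<^sup>+y. ?F x y s * ?F x y t \<partial>\<mu> \<partial>\<mu> \<partial>M \<partial>M)"
    by (intro nn_integral_cong Mm.Fubini') measurable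
  also have "\<dots> = (\<integral>\<^sup>+s. \<integral>\<^sup>+t. f s * f t * (emeasure \<mu> {..min s t} * emeasure \<mu> {max s t<..}) \<partial>M \<partial>M)"
  proof (intro nn_integral_cong)
    fix s t
    \<comment> \<open>Both \<open>s\<close> and \<open>t\<close> lie in the half-open window from
      \<open>x\<close> to \<open>y\<close> exactly when \<open>x \<le> min s t\<close> and
      \<open>max s t < y\<close>. The conditions on \<open>x\<close> and \<open>y\<close> decouple,
      which explains the product form of the kernel.\<close>
    have "(\<integral>\<^sup>+x. \<integral>\<^sup>+y. ?F x y s * ?F x y t \<partial>\<mu> \<partial>\<mu>)
        = (\<integral>\<^sup>+x. \<integral>\<^sup>+y. (f s * f t * indicator {..min s t} x) * indicator {max s t<..} y \<partial>\<mu> \<partial>\<mu>)"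
      by (intro nn_integral_cong) (auto split: split_indicator)
    also have "\<dots> = (\<integral>\<^sup>+x. (f s * f t * indicator {..min s t} x) * emeasure \<mu> {max s t<..} \<partial>\<mu>)"
      by (intro nn_integral_cong, subst nn_integral_cmult) simp_all
    also have "\<dots> = (\<integral>\<^sup>+x. (f s * f t * emeasure \<mu> {max s t<..}) * indicator {..min s t} x  \<partial>\<mu>)"
      by (simp add: ac_simps)
    also have "\<dots> = f s * f t * (emeasure \<mu> {..min s t} * emeasure \<mu> {max s t<..})"
      by (subst nn_integral_cmult) (simp_all add: ac_simps)
    finally show "(\<integral>\<^sup>+x. \<integral>\<^sup>+y. ?F x y s * ?F x y t \<partial>\<mu> \<partial>\<mu>)
        = f s * f t * (emeasure \<mu> {..min s t} * emeasure \<mu> {max s t<..})" .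
  qed
  finally show ?thesis .
qed

section \<open>Weak derivatives on the line\<close>

text \<open>The positive and negative parts of \<open>v\<close> are densities of two finite measures
  that agree on all half-lines, hence coincide. Densities are unique almost everywhere, and the two
  parts of one number are equal only if both vanish.\<close>

lemma AE_eq_0_of_integral_greaterThan:
  fixes v :: "real \<Rightarrow> real"
  assumes v: "integrable lborel v"
    and zero: "\<And>x. (\<integral>y. v y * indicator {x<..} y \<partial>lborel) = 0"
  shows "AE x in lborel. v x = 0"
proof -
  have [measurable]: "v \<in> borel_measurable borel"
    using borel_measurable_integrable[OF v] by simp
  \<comment> \<open>The sign \<open>s\<close> is used with the values 1 and -1, treating both parts
    at once; truncation by \<open>ennreal\<close> selects the positive part of
    \<open>s * v\<close>.\<close>
  have part: "emeasure (density lborel (\<lambda>y. ennreal (s * v y))) {x<..}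
      = ennreal (\<integral>y. max 0 (s * v y) * indicator {x<..} y \<partial>lborel)" for s x
  proof -
    have "emeasure (density lborel (\<lambda>y. ennreal (s * v y))) {x<..}
        = (\<integral>\<^sup>+y. ennreal (s * v y) * indicator {x<..} y \<partial>lborel)"
      by (subst emeasure_density) auto
    also have "\<dots> = (\<integral>\<^sup>+y. ennreal (max 0 (s * v y) * indicator {x<..} y) \<partial>lborel)"
      by (intro nn_integral_cong) (auto simp: max_def ennreal_neg split: split_indicator)
    also have "\<dots> = ennreal (\<integral>y. max 0 (s * v y) * indicator {x<..} y \<partial>lborel)"
      using v by (intro nn_integral_eq_integral integrable_real_mult_indicator) auto
    finally show ?thesis .
  qed
  have int: "integrable lborel (\<lambda>y. max 0 (s * v y) * indicator {x<..} y)" for s x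
    using v by (intro integrable_real_mult_indicator) auto
  have "(\<integral>y. max 0 (1 * v y) * indicator {x<..} y \<partial>lborel)
      = (\<integral>y. max 0 (-1 * v y) * indicator {x<..} y \<partial>lborel)" for x
  proof -
    have "(\<integral>y. max 0 (1 * v y) * indicator {x<..} y \<partial>lborel)
        - (\<integral>y. max 0 (-1 * v y) * indicator {x<..} y \<partial>lborel)
        = (\<integral>y. max 0 (1 * v y) * indicator {x<..} y - max 0 (-1 * v y) * indicator {x<..} y \<partial>lborel)"
      by (rule Bochner_Integration.integral_diff[OF int int, symmetric])
    also have "\<dots> = (\<integral>y. v y * indicator {x<..} y \<partial>lborel)"
      by (intro Bochner_Integration.integral_cong) (auto simp: max_def split: split_indicator)
    finally show ?thesis using zero[of x] by simp
  qed
  then have "density lborel (\<lambda>y. ennreal (1 * v y)) = density lborel (\<lambda>y. ennreal (-1 * v y))"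
    by (intro measure_eqI_lessThan) (simp_all only: part, simp_all)
  then have "AE y in lborel. ennreal (1 * v y) = ennreal (-1 * v y)"
    by (subst (asm) sigma_finite_measure.density_unique_iff[OF sigma_finite_lborel]) auto
  then show ?thesis
  proof eventually_elim
    fix y assume eq: "ennreal (1 * v y) = ennreal (-1 * v y)"
    show "v y = 0"
    proof (cases "0 \<le> v y")
      case True
      then have "ennreal (v y) = 0" using eq by (simp add: ennreal_neg)
      then show ?thesis using True by simp
    next
      case False
      then have "ennreal (- v y) = 0" using eq by (simp add: ennreal_neg)
      then show ?thesis using False by simp
    qed
  qed
qed

section \<open>Test functions, integration by parts and the du Bois-Reymond lemma\<close>

lemma deriv_eq_0_outside:
  fixes \<phi> \<phi>' :: "real \<Rightarrow> real"
  assumes deriv: "\<And>x. (\<phi> has_real_derivative \<phi>' x) (at x)"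
    and zero: "\<And>x. x \<notin> {c..d} \<Longrightarrow> \<phi> x = 0" and x: "x \<notin> {c..d}"
  shows "\<phi>' x = 0"
proof -
  have "((\<lambda>_. 0) has_real_derivative \<phi>' x) (at x)"
    by (rule has_field_derivative_transform_within_open[OF deriv, of "- {c..d}"]) (use zero x in auto)
  then show ?thesis by (rule DERIV_unique) simp
qed

lemma integrable_lborel_continuous_Icc_support:
  fixes \<psi> :: "real \<Rightarrow> real"
  assumes "continuous_on UNIV \<psi>" "\<And>x. x \<notin> {c..d} \<Longrightarrow> \<psi> x = 0"
  shows "integrable lborel \<psi>"
proof -
  have "integrable lborel (\<lambda>x. indicator {c..d} x *\<^sub>R \<psi> x)"
    using assms(1) by (intro borel_integrable_compact) (auto intro: continuous_on_subset)
  also have "(\<lambda>x. indicator {c..d} x *\<^sub>R \<psi> x) = \<psi>"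
    using assms(2) by (auto simp: fun_eq_iff split: split_indicator)
  finally show ?thesis .
qed

lemma integrable_mult_continuous_Icc_support:
  fixes v \<psi> :: "real \<Rightarrow> real"
  assumes v: "integrable lborel v" and \<psi>: "continuous_on UNIV \<psi>" "\<And>x. x \<notin> {c..d} \<Longrightarrow> \<psi> x = 0"
  shows "integrable lborel (\<lambda>x. v x * \<psi> x)"
proof -
  have [measurable]: "v \<in> borel_measurable borel" using borel_measurable_integrable[OF v] by simp
  have [measurable]: "\<psi> \<in> borel_measurable borel" using \<psi>(1) by (rule borel_measurable_continuous_onI)
  have "compact (\<psi> ` {c..d})"
    using \<psi>(1) by (intro compact_continuous_image) (auto intro: continuous_on_subset)
  then have "bounded (\<psi> ` {c..d})" by (rule compact_imp_bounded)
  then obtain B where B: "\<forall>x\<in>{c..d}. \<bar>\<psi> x\<bar> \<le> B"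
    unfolding bounded_iff by auto
  have "integrable lborel (\<lambda>x. B * v x)" using v by simp
  then show ?thesis
  proof (rule Bochner_Integration.integrable_bound)
    show "AE x in lborel. norm (v x * \<psi> x) \<le> norm (B * v x)"
    proof (intro AE_I2)
      fix x
      have "\<bar>v x\<bar> * \<bar>\<psi> x\<bar> \<le> \<bar>v x\<bar> * \<bar>B\<bar>" if "x \<in> {c..d}"
        using bspec[OF B that] by (intro mult_left_mono) auto
      then show "norm (v x * \<psi> x) \<le> norm (B * v x)"
        using \<psi>(2)[of x] by (cases "x \<in> {c..d}") (auto simp: abs_mult mult.commute)
    qed
  qed measurable
qed

text \<open>Integration by parts for a merely integrable \<open>f\<close>, whose primitive need not
  be differentiable everywhere: Fubini over the region \<open>s < x\<close> moves the integration
  onto \<open>\<phi>'\<close>, and the integral of \<open>\<phi>'\<close> beyond \<open>s\<close> is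
  \<open>- \<phi> s\<close>.\<close>

lemma integral_primitive_mult_deriv:
  fixes f \<phi> \<phi>' :: "real \<Rightarrow> real"
  assumes f: "integrable lborel f"
    and deriv: "\<And>x. (\<phi> has_real_derivative \<phi>' x) (at x)"
    and cont: "continuous_on UNIV \<phi>'"
    and zero: "\<And>x. x \<notin> {c..d} \<Longrightarrow> \<phi> x = 0"
  shows "(\<integral>x. (\<integral>s. f s * indicator {..<x} s \<partial>lborel) * \<phi>' x \<partial>lborel) = - (\<integral>s. f s * \<phi> s \<partial>lborel)"
proof -
  have zero': "x \<notin> {c..d} \<Longrightarrow> \<phi>' x = 0" for x
    using deriv zero by (rule deriv_eq_0_outside)
  have int': "integrable lborel \<phi>'"
    using cont zero' by (rule integrable_lborel_continuous_Icc_support)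
  have [measurable]: "f \<in> borel_measurable borel" "\<phi>' \<in> borel_measurable borel"
    using borel_measurable_integrable[OF f] borel_measurable_integrable[OF int'] by simp_all
  have tail: "(\<integral>x. \<phi>' x * indicator {s<..} x \<partial>lborel) = - \<phi> s" for s
  proof -
    \<comment> \<open>Any point to the right of both \<open>s\<close> and the support works; it
      replaces the half-line by a compact interval with \<open>\<phi> D = 0\<close>.\<close>
    define D where "D = max d s + 1"
    have D: "s \<le> D" "d < D" by (auto simp: D_def)
    have "(\<integral>x. \<phi>' x * indicator {s<..} x \<partial>lborel) = (\<integral>x. \<phi>' x * indicator {s..D} x \<partial>lborel)"
    proof (rule integral_cong_AE)
      show "AE x in lborel. \<phi>' x * indicator {s<..} x = \<phi>' x * indicator {s..D} x"
        using AE_lborel_singleton[of s]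
        by eventually_elim (use D zero' in \<open>auto split: split_indicator\<close>)
    qed measurable
    also have "\<dots> = \<phi> D - \<phi> s"
      using D deriv cont by (intro integral_FTC_Icc_real) (auto simp: continuous_on_eq_continuous_at)
    finally show ?thesis using zero[of D] D by simp
  qed
  \<comment> \<open>The separated product is absolutely integrable and dominates its restriction to
    \<open>s < x\<close>, which is what Fubini needs.\<close>
  have prod: "integrable (lborel \<Otimes>\<^sub>M lborel) (\<lambda>(x, s). \<phi>' x * f s)"
  proof (rule lborel_pair.Fubini_integrable)
    show "integrable lborel (\<lambda>x. \<integral>s. norm (case (x, s) of (x, s) \<Rightarrow> \<phi>' x * f s) \<partial>lborel)"
      using int' f by (simp add: abs_mult)
  qed (use f in auto)
  have "integrable (lborel \<Otimes>\<^sub>M lborel) (\<lambda>(x, s). \<phi>' x * f s * (if s < x then 1 else 0))"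
    by (rule Bochner_Integration.integrable_bound[OF prod]) auto
  then have "(\<integral>s. (\<integral>x. \<phi>' x * f s * (if s < x then 1 else 0) \<partial>lborel) \<partial>lborel)
      = (\<integral>x. (\<integral>s. \<phi>' x * f s * (if s < x then 1 else 0) \<partial>lborel) \<partial>lborel)"
    by (rule lborel_pair.Fubini_integral)
  moreover have "(\<integral>x. \<phi>' x * f s * (if s < x then 1 else 0) \<partial>lborel) = - (f s * \<phi> s)" for s
  proof -
    have "(\<integral>x. \<phi>' x * f s * (if s < x then 1 else 0) \<partial>lborel) = (\<integral>x. f s * (\<phi>' x * indicator {s<..} x) \<partial>lborel)"
      by (intro Bochner_Integration.integral_cong) (auto split: split_indicator)
    also have "\<dots> = - (f s * \<phi> s)" using tail[of s] by simp
    finally show ?thesis .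
  qed
  moreover have "(\<integral>s. \<phi>' x * f s * (if s < x then 1 else 0) \<partial>lborel)
      = (\<integral>s. f s * indicator {..<x} s \<partial>lborel) * \<phi>' x" for x
  proof -
    have "(\<integral>s. \<phi>' x * f s * (if s < x then 1 else 0) \<partial>lborel) = (\<integral>s. \<phi>' x * (f s * indicator {..<x} s) \<partial>lborel)"
      by (intro Bochner_Integration.integral_cong) (auto split: split_indicator)
    then show ?thesis by simp
  qed
  ultimately show ?thesis by simp
qed

text \<open>The vanishing total integral is exactly what brings an antiderivative back to its
  starting value to the right of \<open>d\<close>; normalising it to 0 at \<open>c\<close> then
  gives compact support.\<close>

lemma compactly_supported_antiderivative:
  fixes \<theta> :: "real \<Rightarrow> real"
  assumes cd: "c < d" and cont: "continuous_on UNIV \<theta>"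
    and zero: "\<And>x. x \<notin> {c..d} \<Longrightarrow> \<theta> x = 0" and int: "(\<integral>x. \<theta> x \<partial>lborel) = 0"
  obtains \<phi> where "\<And>x. (\<phi> has_real_derivative \<theta> x) (at x)" "\<And>x. x \<notin> {c..d} \<Longrightarrow> \<phi> x = 0"
proof -
  have "isCont \<theta> x" for x using cont by (simp add: continuous_on_eq_continuous_at)
  then obtain F where F: "\<And>x. (F has_real_derivative \<theta> x) (at x)"
    using einterval_antiderivative[of "-\<infinity>" "\<infinity>" \<theta>] by (auto simp: has_real_derivative_iff_has_vector_derivative)
  have inc: "F y - F x = (\<integral>t. \<theta> t * indicator {x..y} t \<partial>lborel)" if "x \<le> y" for x y
    using that F cont by (intro integral_FTC_Icc_real[symmetric]) (auto simp: continuous_on_eq_continuous_at)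
  have left: "F x = F c" if "x < c" for x
  proof -
    have "(\<integral>t. \<theta> t * indicator {x..c} t \<partial>lborel) = 0"
    proof (rule integral_eq_zero_AE)
      show "AE t in lborel. \<theta> t * indicator {x..c} t = 0"
        using AE_lborel_singleton[of c] by eventually_elim (auto simp: zero split: split_indicator)
    qed
    then show ?thesis using inc[of x c] that by simp
  qed
  have right: "F x = F c" if "d < x" for x
  proof -
    have "(\<integral>t. \<theta> t * indicator {c..x} t \<partial>lborel) = (\<integral>t. \<theta> t \<partial>lborel)"
      using that zero by (intro Bochner_Integration.integral_cong) (auto split: split_indicator)
    then show ?thesis using inc[of c x] that cd int by simp
  qed
  show thesis
  proof (rule that[of "\<lambda>x. F x - F c"])
    show "((\<lambda>x. F x - F c) has_real_derivative \<theta> x) (at x)" for x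
      using F by (auto intro!: derivative_eq_intros)
    show "F x - F c = 0" if "x \<notin> {c..d}" for x using that left right by fastforce
  qed
qed

text \<open>A continuous function supported in \<open>{c..d}\<close> with integral zero is the
  derivative of a test function. Subtracting a multiple of a fixed bump from an arbitrary continuous
  \<open>\<psi>\<close> produces such a function, so \<open>u - k\<close> is orthogonal to every
  \<open>\<psi>\<close>. Letting \<open>\<psi>\<close> tend to indicators of intervals gives the
  claim.\<close>

lemma du_bois_reymond:
  fixes u :: "real \<Rightarrow> real"
  assumes cd: "c < d" and u: "set_integrable lborel {c..d} u"
    and weak: "\<And>\<phi> \<phi>'. (\<And>x. (\<phi> has_real_derivative \<phi>' x) (at x)) \<Longrightarrow> continuous_on UNIV \<phi>' \<Longrightarrow>
      (\<And>x. x \<notin> {c..d} \<Longrightarrow> \<phi> x = 0) \<Longrightarrow> (LINT x:{c..d}|lborel. u x * \<phi>' x) = 0"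
  obtains k where "AE x in lborel. x \<in> {c..d} \<longrightarrow> u x = k"
proof -
  define v where "v x = u x * indicator {c..d} x" for x
  have v: "integrable lborel v"
    using u unfolding v_def set_integrable_def by (simp add: mult.commute)
  have [measurable]: "v \<in> borel_measurable borel" using borel_measurable_integrable[OF v] by simp
  \<comment> \<open>Test functions here are only continuously differentiable, so a continuous bump
    suffices. A truncated parabola has the explicit mass \<open>(d - c) ^ 3 / 6\<close>, which is
    positive.\<close>
  define \<beta> where "\<beta> x = max 0 ((x - c) * (d - x))" for x
  have \<beta>_cont: "continuous_on UNIV \<beta>" unfolding \<beta>_def by (intro continuous_intros)
  have \<beta>_zero: "\<beta> x = 0" if "x \<notin> {c..d}" for x
    using that cd by (auto simp: \<beta>_def max_def mult_le_0_iff not_le zero_le_mult_iff)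
  define m where "m = (\<integral>x. \<beta> x \<partial>lborel)"
  have "m = (\<integral>x. (x - c) * (d - x) * indicator {c..d} x \<partial>lborel)"
    unfolding m_def by (intro Bochner_Integration.integral_cong)
      (auto simp: \<beta>_zero split: split_indicator, auto simp: \<beta>_def max_def mult_nonneg_nonneg)
  also have "\<dots> = ((c + d) * d\<^sup>2 / 2 - d ^ 3 / 3 - c * d * d) - ((c + d) * c\<^sup>2 / 2 - c ^ 3 / 3 - c * d * c)"
    using cd by (intro integral_FTC_Icc_real[where F = "\<lambda>x. (c + d) * x\<^sup>2 / 2 - x ^ 3 / 3 - c * d * x"])
      (auto intro!: derivative_eq_intros simp: algebra_simps power2_eq_square)
  also have "\<dots> = (d - c) ^ 3 / 6"
    by (simp add: field_simps power2_eq_square power3_eq_cube)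
  finally have m: "m > 0" by (simp only:) (intro divide_pos_pos zero_less_power, use cd in auto)
  \<comment> \<open>The constant must be the mean of \<open>u\<close> weighted by the bump: testing
    a constant function against \<open>\<beta>\<close> returns that constant times
    \<open>m\<close>.\<close>
  define k where "k = (\<integral>x. v x * \<beta> x \<partial>lborel) / m"
  note bounded_int = integrable_mult_continuous_Icc_support[OF v]
  have const: "(\<integral>x. v x * \<psi> x \<partial>lborel) = k * (\<integral>x. \<psi> x \<partial>lborel)"
    if \<psi>: "continuous_on UNIV \<psi>" "\<And>x. x \<notin> {c..d} \<Longrightarrow> \<psi> x = 0" for \<psi>
  proof -
    define r where "r = (\<integral>x. \<psi> x \<partial>lborel) / m"
    have i\<psi>: "integrable lborel \<psi>" and i\<beta>: "integrable lborel \<beta>"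
      using integrable_lborel_continuous_Icc_support[OF \<psi>] integrable_lborel_continuous_Icc_support[OF \<beta>_cont \<beta>_zero] by auto
    obtain \<phi> where \<phi>: "\<And>x. (\<phi> has_real_derivative (\<psi> x - r * \<beta> x)) (at x)" "\<And>x. x \<notin> {c..d} \<Longrightarrow> \<phi> x = 0"
    proof (rule compactly_supported_antiderivative[OF cd, of "\<lambda>x. \<psi> x - r * \<beta> x"])
      show "(\<integral>x. \<psi> x - r * \<beta> x \<partial>lborel) = 0"
        using i\<psi> i\<beta> m by (simp add: r_def flip: m_def)
    qed (use \<psi> \<beta>_cont \<beta>_zero in \<open>auto intro!: continuous_intros\<close>)
    have "0 = (LINT x:{c..d}|lborel. u x * (\<psi> x - r * \<beta> x))"
      using \<psi>(1) \<beta>_cont by (intro weak[OF \<phi>(1) _ \<phi>(2), symmetric] continuous_intros)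
    also have "\<dots> = (\<integral>x. v x * \<psi> x - r * (v x * \<beta> x) \<partial>lborel)"
      unfolding set_lebesgue_integral_def v_def
      by (intro Bochner_Integration.integral_cong) (auto simp: algebra_simps)
    also have "\<dots> = (\<integral>x. v x * \<psi> x \<partial>lborel) - r * (k * m)"
      using bounded_int[OF \<psi>] bounded_int[OF \<beta>_cont \<beta>_zero] m by (simp add: k_def)
    finally show ?thesis using m by (simp add: r_def)
  qed
  define z where "z x = (u x - k) * indicator {c..d} x" for x
  have z_eq: "z x = v x - k * indicator {c..d} x" for x
    by (auto simp: z_def v_def algebra_simps)
  have z: "integrable lborel z"
    unfolding z_eq[abs_def]
    by (intro Bochner_Integration.integrable_diff v integrable_mult_right integrable_real_indicator) (auto simp: emeasure_lborel_Icc_eq)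
  have [measurable]: "z \<in> borel_measurable borel" using borel_measurable_integrable[OF z] by simp
  have interval: "(\<integral>x. z x * indicator {l<..<d} x \<partial>lborel) = 0" if l: "c \<le> l" for l
  proof -
    \<comment> \<open>Trapezoids with slopes \<open>n\<close> at both ends, converging pointwise to
      the indicator of the open interval and bounded by 1, hence suited to dominated
      convergence.\<close>
    define \<rho> where "\<rho> n x = max 0 (min 1 (real n * min (x - l) (d - x)))" for n :: nat and x
    have \<rho>_cont: "continuous_on UNIV (\<rho> n)" for n unfolding \<rho>_def[abs_def] by (intro continuous_intros)
    have \<rho>_zero: "\<rho> n x = 0" if "x \<notin> {l<..<d}" for n x
    proof -
      have "real n * min (x - l) (d - x) \<le> 0"
        using that by (intro mult_nonneg_nonpos) auto
      then show ?thesis by (simp add: \<rho>_def)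
    qed
    have [measurable]: "\<rho> n \<in> borel_measurable borel" for n
      using \<rho>_cont by (rule borel_measurable_continuous_onI)
    have zero: "(\<integral>x. z x * \<rho> n x \<partial>lborel) = 0" for n
    proof -
      have out: "\<rho> n x = 0" if "x \<notin> {c..d}" for x using that l by (intro \<rho>_zero) auto
      have "(\<integral>x. z x * \<rho> n x \<partial>lborel) = (\<integral>x. v x * \<rho> n x - k * \<rho> n x \<partial>lborel)"
        unfolding z_eq by (intro Bochner_Integration.integral_cong) (auto simp: out algebra_simps split: split_indicator)
      also have "\<dots> = 0"
        using bounded_int[OF \<rho>_cont out] integrable_lborel_continuous_Icc_support[OF \<rho>_cont out] const[OF \<rho>_cont out]
        by simp
      finally show ?thesis .
    qed
    have "(\<lambda>n. \<integral>x. z x * \<rho> n x \<partial>lborel) \<longlonglongrightarrow> (\<integral>x. z x * indicator {l<..<d} x \<partial>lborel)"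
    proof (rule integral_dominated_convergence[where w = "\<lambda>x. norm (z x)"])
      show "AE x in lborel. (\<lambda>n. z x * \<rho> n x) \<longlonglongrightarrow> z x * indicator {l<..<d} x"
      proof (intro AE_I2 tendsto_mult tendsto_const)
        fix x
        show "(\<lambda>n. \<rho> n x) \<longlonglongrightarrow> indicator {l<..<d} x"
        proof (cases "x \<in> {l<..<d}")
          case True
          then have e: "0 < min (x - l) (d - x)" by auto
          obtain N :: nat where N: "1 / min (x - l) (d - x) \<le> real N" using real_arch_simple by blast
          have "\<rho> n x = 1" if "N \<le> n" for n
          proof -
            have "1 / min (x - l) (d - x) \<le> real n" using N that by linarith
            then have "1 \<le> real n * min (x - l) (d - x)" using e by (simp add: pos_divide_le_eq)
            then show ?thesis by (simp add: \<rho>_def)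
          qed
          then have "\<forall>\<^sub>F n in sequentially. \<rho> n x = indicator {l<..<d} x"
            using True by (auto simp: eventually_sequentially)
          then show ?thesis by (rule tendsto_eventually)
        qed (simp add: \<rho>_zero)
      qed
      show "AE x in lborel. norm (z x * \<rho> n x) \<le> norm (z x)" for n
        by (intro AE_I2) (auto simp: abs_mult \<rho>_def intro!: mult_left_le)
    qed (use z in auto)
    then show ?thesis using zero by (simp add: LIMSEQ_const_iff)
  qed
  have "AE x in lborel. z x = 0"
  proof (rule AE_eq_0_of_integral_greaterThan[OF z])
    fix x
    \<comment> \<open>Since \<open>z\<close> vanishes outside \<open>{c..d}\<close>, a half-line may
      be replaced by an interval ending at \<open>d\<close>; the endpoints form a null set.\<close>
    have "(\<integral>y. z y * indicator {x<..} y \<partial>lborel) = (\<integral>y. z y * indicator {max c x<..<d} y \<partial>lborel)"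
    proof (rule integral_cong_AE)
      show "AE y in lborel. z y * indicator {x<..} y = z y * indicator {max c x<..<d} y"
        using AE_lborel_singleton[of c] AE_lborel_singleton[of d]
        by eventually_elim (auto simp: z_def split: split_indicator)
    qed measurable
    also have "\<dots> = 0" by (intro interval) simp
    finally show "(\<integral>y. z y * indicator {x<..} y \<partial>lborel) = 0" .
  qed
  then have "AE x in lborel. x \<in> {c..d} \<longrightarrow> u x = k"
    by eventually_elim (auto simp: z_def split: split_indicator_asm)
  then show thesis by (rule that)
qed

section \<open>Primitives of integrable functions and weak derivatives\<close>

definition primitive :: "(real \<Rightarrow> real) \<Rightarrow> real \<Rightarrow> real" where
  "primitive f x = (\<integral>s. f s * indicator {..<x} s \<partial>lborel)"

lemma primitive_measurable:
  assumes "integrable lborel f"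
  shows "primitive f \<in> borel_measurable borel"
proof -
  have [measurable]: "f \<in> borel_measurable borel"
    using borel_measurable_integrable[OF assms] by simp
  have "primitive f = (\<lambda>x. \<integral>s. f s * (if s < x then 1 else 0) \<partial>lborel)"
    unfolding primitive_def[abs_def]
    by (intro ext Bochner_Integration.integral_cong) (auto split: split_indicator)
  also have "\<dots> \<in> borel_measurable borel" by measurable
  finally show ?thesis .
qed

lemma abs_primitive_le:
  assumes "integrable lborel f"
  shows "\<bar>primitive f x\<bar> \<le> (\<integral>s. \<bar>f s\<bar> \<partial>lborel)"
  unfolding primitive_def
  using assms by (intro order_trans[OF integral_abs_bound] integral_mono integrable_abs integrable_real_mult_indicator)
    (auto split: split_indicator)

text \<open>Integrating over \<open>{..<x}\<close> makes the window of an increment half-open,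
  matching the condition \<open>x \<le> s \<and> s < y\<close> in the increment form of the
  variance.\<close>

lemma primitive_diff:
  assumes "integrable lborel f" "x \<le> y"
  shows "primitive f y - primitive f x = (\<integral>s. f s * indicator {x..<y} s \<partial>lborel)"
proof -
  have "primitive f y - primitive f x = (\<integral>s. f s * indicator {..<y} s - f s * indicator {..<x} s \<partial>lborel)"
    unfolding primitive_def using assms(1)
    by (intro Bochner_Integration.integral_diff[symmetric] integrable_real_mult_indicator) auto
  also have "\<dots> = (\<integral>s. f s * indicator {x..<y} s \<partial>lborel)"
    using assms(2) by (intro Bochner_Integration.integral_cong) (auto split: split_indicator)
  finally show ?thesis .
qed

lemma set_integrable_Icc_bounded:
  fixes h :: "real \<Rightarrow> real"
  assumes [measurable]: "h \<in> borel_measurable borel" and "\<And>x. \<bar>h x\<bar> \<le> B"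
  shows "set_integrable lborel {c..d} h"
  unfolding set_integrable_def
proof (rule Bochner_Integration.integrable_bound)
  show "integrable lborel (\<lambda>x. B * indicator {c..d} x)"
    by (intro integrable_mult_right integrable_real_indicator) (auto simp: emeasure_lborel_Icc_eq)
  show "AE x in lborel. norm (indicator {c..d} x *\<^sub>R h x) \<le> norm (B * indicator {c..d} x)"
    using assms(2) by (intro AE_I2) (auto split: split_indicator intro: order_trans[OF _ abs_ge_self])
qed measurable

lemma set_integral_eq_of_zero_outside:
  fixes f :: "real \<Rightarrow> real"
  assumes "\<And>x. x \<notin> A \<Longrightarrow> f x = 0"
  shows "(LINT x:A|lborel. f x) = (\<integral>x. f x \<partial>lborel)"
  unfolding set_lebesgue_integral_def
  using assms by (intro Bochner_Integration.integral_cong) (auto split: split_indicator)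

lemma oint_eq_einterval: "oint a b = einterval a b"
  by (simp add: oint_def einterval_def)

lemma Icc_subset_oint: "a < ereal c \<Longrightarrow> ereal d < b \<Longrightarrow> {c..d} \<subseteq> oint a b"
  unfolding oint_def by (auto intro: less_le_trans le_less_trans simp flip: ereal_less_eq(3))

text \<open>A test function and its derivative vanish outside a compact subinterval of
  \<open>oint a b\<close>, so integrals over the interval equal integrals over the line, where
  integration by parts is available.\<close>

lemma weak_deriv_primitive:
  assumes f: "integrable lborel f"
  shows "weak_deriv a b (primitive f) f"
  unfolding weak_deriv_def
proof (intro conjI allI impI)
  have [measurable]: "f \<in> borel_measurable borel"
    using borel_measurable_integrable[OF f] by simp
  show "loc_int a b (primitive f)"
    unfolding loc_int_def
    using set_integrable_Icc_bounded[OF primitive_measurable[OF f] abs_primitive_le[OF f]] by blast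
  show "loc_int a b f"
    unfolding loc_int_def set_integrable_def by (intro allI impI integrable_mult_indicator f) auto
next
  fix \<phi> \<phi>' :: "real \<Rightarrow> real"
  assume "(\<forall>x. (\<phi> has_real_derivative \<phi>' x) (at x)) \<and> continuous_on UNIV \<phi>' \<and>
    (\<exists>c d. a < ereal c \<and> ereal d < b \<and> (\<forall>x. x \<notin> {c..d} \<longrightarrow> \<phi> x = 0))"
  then obtain c d where deriv: "\<And>x. (\<phi> has_real_derivative \<phi>' x) (at x)"
    and cont: "continuous_on UNIV \<phi>'" and cd: "a < ereal c" "ereal d < b"
    and zero: "\<And>x. x \<notin> {c..d} \<Longrightarrow> \<phi> x = 0" by blast
  have zero': "x \<notin> {c..d} \<Longrightarrow> \<phi>' x = 0" for x
    using deriv zero by (rule deriv_eq_0_outside)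
  have out: "\<phi>' x = 0" "\<phi> x = 0" if "x \<notin> oint a b" for x
    using that Icc_subset_oint[OF cd] zero zero' by blast+
  have "(LINT x:oint a b|lborel. primitive f x * \<phi>' x) = (\<integral>x. primitive f x * \<phi>' x \<partial>lborel)"
    using out by (intro set_integral_eq_of_zero_outside) simp
  also have "\<dots> = - (\<integral>x. f x * \<phi> x \<partial>lborel)"
    unfolding primitive_def by (rule integral_primitive_mult_deriv[OF f deriv cont zero])
  also have "(\<integral>x. f x * \<phi> x \<partial>lborel) = (LINT x:oint a b|lborel. f x * \<phi> x)"
    using out by (intro set_integral_eq_of_zero_outside[symmetric]) simp
  finally show "(LINT x:oint a b|lborel. primitive f x * \<phi>' x) = - (LINT x:oint a b|lborel. f x * \<phi> x)" .
qed

text \<open>The difference of \<open>h\<close> and a primitive of the cut-off derivative annihilates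
  derivatives of all test functions supported in \<open>{c..d}\<close>, so it is constant there. The
  cut-off is needed because \<open>h'\<close> is only locally integrable.\<close>

lemma weak_deriv_imp_primitive_on_Icc:
  assumes wd: "weak_deriv a b h h'" and cd: "a < ereal c" "c < d" "ereal d < b"
  obtains k where "AE x in lborel. x \<in> {c..d} \<longrightarrow> h x = k + primitive (\<lambda>s. indicator {c..d} s * h' s) x"
proof -
  define f where "f s = indicator {c..d} s * h' s" for s
  have loc: "set_integrable lborel {c..d} h" "set_integrable lborel {c..d} h'"
    using wd cd unfolding weak_deriv_def loc_int_def by auto
  have f: "integrable lborel f"
    using loc(2) unfolding f_def set_integrable_def by simp
  have F: "set_integrable lborel {c..d} (primitive f)"
    using set_integrable_Icc_bounded[OF primitive_measurable[OF f] abs_primitive_le[OF f]] .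
  have "\<exists>k. AE x in lborel. x \<in> {c..d} \<longrightarrow> h x - primitive f x = k"
  proof (rule du_bois_reymond[OF cd(2)])
    show "set_integrable lborel {c..d} (\<lambda>x. h x - primitive f x)"
      using loc(1) F by (rule set_integral_diff)
  next
    fix \<phi> \<phi>' :: "real \<Rightarrow> real"
    assume deriv: "\<And>x. (\<phi> has_real_derivative \<phi>' x) (at x)" and cont: "continuous_on UNIV \<phi>'"
      and zero: "\<And>x. x \<notin> {c..d} \<Longrightarrow> \<phi> x = 0"
    have zero': "x \<notin> {c..d} \<Longrightarrow> \<phi>' x = 0" for x
      using deriv zero by (rule deriv_eq_0_outside)
    have out: "\<phi>' x = 0" "\<phi> x = 0" if "x \<notin> oint a b" for x
      using that Icc_subset_oint[OF cd(1,3)] zero zero' by blast+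
    have int: "set_integrable lborel {c..d} (\<lambda>x. v x * \<phi>' x)" if "set_integrable lborel {c..d} v" for v
      using integrable_mult_continuous_Icc_support[OF that[unfolded set_integrable_def] cont zero']
      unfolding set_integrable_def by (simp add: mult.assoc)
    have "(LINT x:{c..d}|lborel. h x * \<phi>' x) = (LINT x:oint a b|lborel. h x * \<phi>' x)"
      using out zero' by (subst (1 2) set_integral_eq_of_zero_outside) simp_all
    also have "\<dots> = - (LINT x:oint a b|lborel. h' x * \<phi> x)"
      using wd deriv cont zero cd unfolding weak_deriv_def by blast
    also have "(LINT x:oint a b|lborel. h' x * \<phi> x) = (\<integral>x. f x * \<phi> x \<partial>lborel)"
    proof -
      have "(LINT x:oint a b|lborel. h' x * \<phi> x) = (\<integral>x. h' x * \<phi> x \<partial>lborel)"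
        using out by (intro set_integral_eq_of_zero_outside) simp
      also have "\<dots> = (\<integral>x. f x * \<phi> x \<partial>lborel)"
        using zero by (intro Bochner_Integration.integral_cong) (auto simp: f_def split: split_indicator)
      finally show ?thesis .
    qed
    also have "- (\<integral>x. f x * \<phi> x \<partial>lborel) = (\<integral>x. primitive f x * \<phi>' x \<partial>lborel)"
      unfolding primitive_def by (rule integral_primitive_mult_deriv[OF f deriv cont zero, symmetric])
    also have "\<dots> = (LINT x:{c..d}|lborel. primitive f x * \<phi>' x)"
      using zero' by (intro set_integral_eq_of_zero_outside[symmetric]) auto
    finally have "(LINT x:{c..d}|lborel. h x * \<phi>' x) - (LINT x:{c..d}|lborel. primitive f x * \<phi>' x) = 0"
      by simp
    then show "(LINT x:{c..d}|lborel. (h x - primitive f x) * \<phi>' x) = 0"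
      using set_integral_diff(2)[OF int[OF loc(1)] int[OF F]] by (simp add: left_diff_distrib)
  qed blast
  then obtain k where "AE x in lborel. x \<in> {c..d} \<longrightarrow> h x - primitive f x = k" by blast
  then have "AE x in lborel. x \<in> {c..d} \<longrightarrow> h x = k + primitive f x"
    by eventually_elim auto
  then show thesis unfolding f_def by (rule that)
qed

section \<open>The Poincare inequality as a form bound\<close>

locale weighted_interval =
  fixes a b :: ereal and p w :: "real \<Rightarrow> real"
  assumes ab: "a < b"
    and p_meas[measurable]: "p \<in> borel_measurable borel"
    and p_int: "set_integrable lborel (oint a b) p"
    and p_one: "(LINT x:oint a b|lborel. p x) = 1"
    and p_pos: "AE x in lborel. x \<in> oint a b \<longrightarrow> p x > 0"
    and w_meas[measurable]: "w \<in> borel_measurable borel"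
    and w_pos: "AE x in lborel. x \<in> oint a b \<longrightarrow> w x > 0"
begin

text \<open>Restricting Lebesgue measure by a density instead of a subspace keeps the whole line as
  space and the Borel sets as sigma-algebra, so measurability never refers to the interval.\<close>

definition M :: "real measure" where
  "M = density lborel (\<lambda>x. ennreal (indicator (oint a b) x))"

definition \<mu> :: "real measure" where
  "\<mu> = density M (\<lambda>x. ennreal (p x))"

lemma oint_borel[measurable]: "oint a b \<in> sets borel"
  by (simp add: oint_eq_einterval)

lemma sets_M[measurable_cong, simp]: "sets M = sets borel" by (simp add: M_def)
lemma sets_mu[measurable_cong, simp]: "sets \<mu> = sets borel" by (simp add: \<mu>_def)
lemma space_M[simp]: "space M = UNIV" by (simp add: M_def)
lemma space_mu[simp]: "space \<mu> = UNIV" by (simp add: \<mu>_def)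

lemma AE_M: "(AE x in M. P x) \<longleftrightarrow> (AE x in lborel. x \<in> oint a b \<longrightarrow> P x)"
  unfolding M_def by (subst AE_density) (auto simp: indicator_def intro!: eventually_cong)

lemma AE_M_oint: "AE x in M. x \<in> oint a b"
  by (simp add: AE_M)

lemma AE_M_pos: "AE x in M. p x > 0" "AE x in M. w x > 0"
  using p_pos w_pos by (auto simp: AE_M)

lemma nn_integral_M:
  assumes [measurable]: "f \<in> borel_measurable borel"
  shows "(\<integral>\<^sup>+x. f x \<partial>M) = (\<integral>\<^sup>+x. indicator (oint a b) x * f x \<partial>lborel)"
  unfolding M_def by (subst nn_integral_density) (auto simp: ennreal_indicator)

lemma integral_M:
  assumes [measurable]: "f \<in> borel_measurable borel"
  shows "(\<integral>x. f x \<partial>M) = (LINT x:oint a b|lborel. f x :: real)"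
  unfolding M_def set_lebesgue_integral_def by (subst integral_density) auto

lemma integrable_M:
  assumes [measurable]: "f \<in> borel_measurable borel"
  shows "integrable M f \<longleftrightarrow> set_integrable lborel (oint a b) (f :: real \<Rightarrow> real)"
  unfolding M_def set_integrable_def by (subst integrable_density) auto

lemma sigma_finite_M: "sigma_finite_measure M"
  unfolding M_def
  by (subst sigma_finite_measure.sigma_finite_iff_density_finite[OF sigma_finite_lborel]) auto

lemma integral_mu:
  assumes [measurable]: "f \<in> borel_measurable borel"
  shows "(\<integral>x. f x \<partial>\<mu>) = (LINT x:oint a b|lborel. f x * p x :: real)"
proof -
  have "(\<integral>x. f x \<partial>\<mu>) = (\<integral>x. p x *\<^sub>R f x \<partial>M)"
    unfolding \<mu>_def using AE_M_pos(1) by (subst integral_density) (auto elim: eventually_mono)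
  then show ?thesis by (simp add: integral_M mult.commute)
qed

lemma integrable_mu:
  assumes [measurable]: "f \<in> borel_measurable borel"
  shows "integrable \<mu> f \<longleftrightarrow> set_integrable lborel (oint a b) (\<lambda>x. f x * p x :: real)"
proof -
  have "integrable \<mu> f \<longleftrightarrow> integrable M (\<lambda>x. p x *\<^sub>R f x)"
    unfolding \<mu>_def using AE_M_pos(1) by (subst integrable_density) (auto elim: eventually_mono)
  then show ?thesis by (simp add: integrable_M mult.commute)
qed

section \<open>The probability measure with density \<open>p\<close>, its distribution function and
  the kernel\<close>

lemma emeasure_mu:
  assumes [measurable]: "A \<in> sets borel"
  shows "emeasure \<mu> A = ennreal (LINT x:oint a b|lborel. p x * indicator A x)"
proof -
  have "emeasure \<mu> A = (\<integral>\<^sup>+x. ennreal (p x * indicator A x) \<partial>M)"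
    unfolding \<mu>_def
    by (subst emeasure_density) (auto intro!: nn_integral_cong split: split_indicator)
  also have "\<dots> = ennreal (\<integral>x. p x * indicator A x \<partial>M)"
    using p_int AE_M_pos(1)
    by (intro nn_integral_eq_integral integrable_real_mult_indicator)
      (auto simp: integrable_M elim!: eventually_mono split: split_indicator)
  finally show ?thesis by (simp add: integral_M)
qed

lemma emeasure_mu_UNIV: "emeasure \<mu> UNIV = 1"
  using p_one by (simp add: emeasure_mu)

lemma finite_mu: "finite_measure \<mu>"
  by (rule finite_measureI) (simp add: emeasure_mu_UNIV)

text \<open>This puts the distribution function strictly between 0 and 1 inside the interval, and so
  makes the kernel strictly positive there.\<close>

lemma emeasure_mu_Ioo_pos:
  assumes "l < u" "{l<..<u} \<subseteq> oint a b"
  shows "0 < emeasure \<mu> {l<..<u}"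
proof (rule ccontr)
  assume "\<not> 0 < emeasure \<mu> {l<..<u}"
  then have "(\<integral>\<^sup>+x. ennreal (p x) * indicator {l<..<u} x \<partial>M) = 0"
    unfolding \<mu>_def by (simp add: emeasure_density)
  then have "AE x in M. ennreal (p x) * indicator {l<..<u} x = 0"
    by (subst (asm) nn_integral_0_iff_AE) auto
  with AE_M_pos(1) have "AE x in M. x \<notin> {l<..<u}"
    by eventually_elim (auto split: split_indicator_asm)
  then have "AE x in lborel. x \<notin> {l<..<u}"
    unfolding AE_M by eventually_elim (use assms(2) in auto)
  then have "emeasure lborel {l<..<u} = 0"
    by (subst (asm) AE_iff_measurable[of "{l<..<u}"]) auto
  then show False using assms(1) by simp
qed

lemma cdf_eq:
  assumes x: "x \<in> oint a b"
  shows "ennreal (cdf a p x) = emeasure \<mu> {..x}" "ennreal (1 - cdf a p x) = emeasure \<mu> {x<..}"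
    "0 < cdf a p x" "cdf a p x < 1"
proof -
  have ax: "a < ereal x" "ereal x < b" using x by (auto simp: oint_def)
  have "cdf a p x = (LINT y:einterval a x|lborel. p y)"
    unfolding cdf_def interval_lebesgue_integral_def using ax by (simp add: less_imp_le)
  also have "\<dots> = (LINT y:oint a b|lborel. p y * indicator {..x} y)"
    unfolding set_lebesgue_integral_def
  proof (rule integral_cong_AE)
    show "AE y in lborel. indicator (einterval a (ereal x)) y *\<^sub>R p y
        = indicator (oint a b) y *\<^sub>R (p y * indicator {..x} y)"
      using AE_lborel_singleton[of x]
    proof eventually_elim
      fix y assume "y \<noteq> x"
      moreover have "ereal y < b" if "y \<le> x" using that ax(2) by (metis ereal_less_eq(3) le_less_trans)
      ultimately show "indicator (einterval a (ereal x)) y *\<^sub>R p y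
        = indicator (oint a b) y *\<^sub>R (p y * indicator {..x} y)"
        by (auto simp: einterval_def oint_def split: split_indicator)
    qed
  qed auto
  finally have eq: "cdf a p x = (LINT y:oint a b|lborel. p y * indicator {..x} y)" .
  then show *: "ennreal (cdf a p x) = emeasure \<mu> {..x}" by (simp add: emeasure_mu)
  have int: "set_integrable lborel (oint a b) (\<lambda>y. p y * indicator A y)" if "A \<in> sets borel" for A
    using integrable_real_mult_indicator[of A M p] that p_int by (simp add: integrable_M)
  have "1 - cdf a p x = (LINT y:oint a b|lborel. p y) - (LINT y:oint a b|lborel. p y * indicator {..x} y)"
    by (simp add: eq p_one)
  also have "\<dots> = (LINT y:oint a b|lborel. p y - p y * indicator {..x} y)"
    using p_int int[of "{..x}"] by (intro set_integral_diff(2)[symmetric]) auto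
  also have "\<dots> = (LINT y:oint a b|lborel. p y * indicator {x<..} y)"
    by (intro set_lebesgue_integral_cong) (auto split: split_indicator)
  finally show **: "ennreal (1 - cdf a p x) = emeasure \<mu> {x<..}" by (simp add: emeasure_mu)
  obtain l where l: "a < ereal l" "ereal l < ereal x" using ereal_dense2[OF ax(1)] by auto
  have "0 < emeasure \<mu> {l<..<x}"
    using l(2) Icc_subset_oint[OF l(1) ax(2)] by (intro emeasure_mu_Ioo_pos) auto
  also have "\<dots> \<le> emeasure \<mu> {..x}" by (intro emeasure_mono) auto
  finally show "0 < cdf a p x" unfolding *[symmetric] by simp
  obtain u where u: "ereal x < ereal u" "ereal u < b" using ereal_dense2[OF ax(2)] by auto
  have "0 < emeasure \<mu> {x<..<u}"
    using u(1) Icc_subset_oint[OF ax(1) u(2)] by (intro emeasure_mu_Ioo_pos) auto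
  also have "\<dots> \<le> emeasure \<mu> {x<..}" by (intro emeasure_mono) auto
  finally show "cdf a p x < 1" unfolding **[symmetric] by simp
qed

lemma cdf_measurable[measurable]: "cdf a p \<in> borel_measurable borel"
proof -
  \<comment> \<open>Measurability concerns the whole line, so the points left of \<open>a\<close>
    matter too: there the interval integral reverses orientation and changes sign.\<close>
  have "cdf a p = (\<lambda>x. if a \<le> ereal x
      then (\<integral>y. (if a < ereal y \<and> y < x then 1 else 0) *\<^sub>R p y \<partial>lborel)
      else - (\<integral>y. (if x < y \<and> ereal y < a then 1 else 0) *\<^sub>R p y \<partial>lborel))"
    unfolding cdf_def interval_lebesgue_integral_def set_lebesgue_integral_def fun_eq_iff
    by (auto simp: einterval_def intro!: Bochner_Integration.integral_cong split: split_indicator)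
  also have "\<dots> \<in> borel_measurable borel" by measurable
  finally show ?thesis .
qed

lemma kernK_measurable[measurable]: "(\<lambda>(x, y). kernK a p x y) \<in> borel_measurable (borel \<Otimes>\<^sub>M borel)"
  unfolding kernK_def by measurable

lemma kernK_pos: "x \<in> oint a b \<Longrightarrow> y \<in> oint a b \<Longrightarrow> 0 < kernK a p x y"
  unfolding kernK_def using cdf_eq(3,4)[of "min x y"] cdf_eq(3,4)[of "max x y"]
  by (auto simp: min_def max_def)

lemma kernK_eq:
  assumes "s \<in> oint a b" "t \<in> oint a b"
  shows "ennreal (kernK a p s t) = emeasure \<mu> {..min s t} * emeasure \<mu> {max s t<..}"
proof -
  have "min s t \<in> oint a b" "max s t \<in> oint a b" using assms by (auto simp: min_def max_def)
  then show ?thesis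
    unfolding kernK_def by (simp add: ennreal_mult'' cdf_eq(4) less_imp_le flip: cdf_eq(1,2))
qed

section \<open>Poincare constants versus bounds on the kernel form\<close>

sublocale symmetric_kernel M "\<lambda>x y. ennreal (kernK a p x y)" "\<lambda>x. p x * w x"
proof -
  interpret sigma_finite_measure M by (rule sigma_finite_M)
  show "symmetric_kernel M (\<lambda>x y. ennreal (kernK a p x y)) (\<lambda>x. p x * w x)"
  proof
    show "(\<lambda>(x, y). ennreal (kernK a p x y)) \<in> borel_measurable (M \<Otimes>\<^sub>M M)" by measurable
    show "ennreal (kernK a p x y) = ennreal (kernK a p y x)" for x y
      by (simp add: kernK_def min.commute max.commute)
    show "AE x in M. 0 < p x * w x" using AE_M_pos by eventually_elim simp
  qed measurable
qed

text \<open>Hoeffding's formula with the kernel inserted. \<open>kernK\<close> is the product of the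
  two tail measures only for arguments inside the interval, hence the almost-everywhere comparison
  with respect to \<open>M\<close>.\<close>

lemma kform_eq_increments:
  assumes [measurable]: "f \<in> borel_measurable borel"
  shows "kform f = (\<integral>\<^sup>+x. \<integral>\<^sup>+y. (\<integral>\<^sup>+s. (if x \<le> s \<and> s < y then ennreal (f s) else 0) \<partial>M)\<^sup>2 \<partial>\<mu> \<partial>\<mu>)"
proof -
  interpret mu: finite_measure \<mu> by (rule finite_mu)
  have "(\<integral>\<^sup>+x. \<integral>\<^sup>+y. (\<integral>\<^sup>+s. (if x \<le> s \<and> s < y then ennreal (f s) else 0) \<partial>M)\<^sup>2 \<partial>\<mu> \<partial>\<mu>)
      = (\<integral>\<^sup>+s. \<integral>\<^sup>+t. ennreal (f s) * ennreal (f t) * (emeasure \<mu> {..min s t} * emeasure \<mu> {max s t<..}) \<partial>M \<partial>M)"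
    by (intro nn_integral_increment_square) (auto intro: sigma_finite_M mu.sigma_finite_measure_axioms)
  also have "\<dots> = (\<integral>\<^sup>+s. ennreal (f s) * kop f s \<partial>M)"
  proof (rule nn_integral_cong_AE, use AE_M_oint in eventually_elim)
    fix s assume s: "s \<in> oint a b"
    have "(\<integral>\<^sup>+t. ennreal (f s) * ennreal (f t) * (emeasure \<mu> {..min s t} * emeasure \<mu> {max s t<..}) \<partial>M)
        = (\<integral>\<^sup>+t. ennreal (f s) * (ennreal (kernK a p s t) * ennreal (f t)) \<partial>M)"
      by (rule nn_integral_cong_AE, use AE_M_oint in eventually_elim) (simp add: kernK_eq s ac_simps)
    also have "\<dots> = ennreal (f s) * kop f s"
      unfolding kop_def by (intro nn_integral_cmult) measurable
    finally show "(\<integral>\<^sup>+t. ennreal (f s) * ennreal (f t) * (emeasure \<mu> {..min s t} * emeasure \<mu> {max s t<..}) \<partial>M)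
        = ennreal (f s) * kop f s" .
  qed
  finally show ?thesis unfolding kform_def by simp
qed

lemma Var_p_eq_increments:
  assumes "L2w a b p h"
  shows "ennreal (Var_p a b p h)
    = (\<integral>\<^sup>+x. \<integral>\<^sup>+y. (if x < y then ennreal ((h y - h x)\<^sup>2) else 0) \<partial>\<mu> \<partial>\<mu>)"
proof -
  have [measurable]: "h \<in> borel_measurable borel" using assms by (simp add: L2w_def)
  have "ennreal ((\<integral>x. (h x)\<^sup>2 \<partial>\<mu>) - (\<integral>x. h x \<partial>\<mu>)\<^sup>2)
      = (\<integral>\<^sup>+x. \<integral>\<^sup>+y. (if x < y then ennreal ((h y - h x)\<^sup>2) else 0) \<partial>\<mu> \<partial>\<mu>)"
    using assms by (intro variance_eq_nn_integral_pairs) (auto simp: emeasure_mu_UNIV integrable_mu L2w_def)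
  then show ?thesis by (simp add: Var_p_def integral_mu)
qed

lemma L2w_iff_sqnorm:
  assumes [measurable]: "f \<in> borel_measurable borel"
  shows "L2w a b (\<lambda>x. p x * w x) f \<longleftrightarrow> sqnorm f < \<infinity>"
proof -
  have "L2w a b (\<lambda>x. p x * w x) f \<longleftrightarrow> integrable M (\<lambda>x. (f x)\<^sup>2 * (p x * w x))"
    by (simp add: L2w_def integrable_M)
  also have "\<dots> \<longleftrightarrow> sqnorm f < \<infinity>"
  proof -
    have "(\<integral>\<^sup>+x. ennreal (norm ((f x)\<^sup>2 * (p x * w x))) \<partial>M) = sqnorm f"
      unfolding sqnorm_def by (rule nn_integral_cong_AE, use q_pos in eventually_elim) simp
    then show ?thesis unfolding integrable_iff_bounded by simp
  qed
  finally show ?thesis .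
qed

lemma sqnorm_eq:
  assumes "L2w a b (\<lambda>x. p x * w x) f"
  shows "sqnorm f = ennreal (LINT x:oint a b|lborel. (f x)\<^sup>2 * w x * p x)"
proof -
  have [measurable]: "f \<in> borel_measurable borel" using assms by (simp add: L2w_def)
  have "sqnorm f = ennreal (\<integral>x. (f x)\<^sup>2 * (p x * w x) \<partial>M)"
    unfolding sqnorm_def
  proof (rule nn_integral_eq_integral)
    show "integrable M (\<lambda>x. (f x)\<^sup>2 * (p x * w x))" using assms by (simp add: L2w_def integrable_M)
    show "AE x in M. 0 \<le> (f x)\<^sup>2 * (p x * w x)" using q_pos by eventually_elim simp
  qed
  also have "(\<integral>x. (f x)\<^sup>2 * (p x * w x) \<partial>M) = (LINT x:oint a b|lborel. (f x)\<^sup>2 * w x * p x)"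
    by (simp add: integral_M ac_simps)
  finally show ?thesis .
qed

text \<open>On each interval of a compact exhaustion \<open>h\<close> is almost everywhere a
  constant plus a primitive of \<open>h'\<close>. Two points can be placed in a common interval,
  where the constant cancels, and taking the modulus inside the integral gives the bound.\<close>

lemma weak_deriv_increment_le:
  assumes wd: "weak_deriv a b h h'" and [measurable]: "h' \<in> borel_measurable borel"
  shows "AE x in M. AE y in M. x < y \<longrightarrow>
    ennreal \<bar>h y - h x\<bar> \<le> (\<integral>\<^sup>+s. (if x \<le> s \<and> s < y then ennreal \<bar>h' s\<bar> else 0) \<partial>M)"
proof -
  obtain u l :: "nat \<Rightarrow> real" where
    un: "einterval a b = (\<Union>i. {l i .. u i})" and mono: "incseq u" "decseq l"
    and lu: "\<And>i. l i < u i" "\<And>i. a < ereal (l i)" "\<And>i. ereal (u i) < b"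
    by (rule einterval_Icc_approximation[OF ab]) (rule that; assumption)
  define f where "f i s = indicator {l i..u i} s * h' s" for i s
  have f: "integrable lborel (f i)" for i
    using wd lu unfolding weak_deriv_def loc_int_def f_def set_integrable_def by simp
  have "\<exists>k. AE x in lborel. x \<in> {l i..u i} \<longrightarrow> h x = k + primitive (f i) x" for i
    using weak_deriv_imp_primitive_on_Icc[OF wd lu(2) lu(1) lu(3), of i] unfolding f_def by blast
  then obtain k where k: "\<And>i. AE x in lborel. x \<in> {l i..u i} \<longrightarrow> h x = k i + primitive (f i) x" by metis
  \<comment> \<open>The exceptional null set depends on \<open>i\<close>; as there are countably
    many, the points good for every compact interval still have full measure.\<close>
  define G where "G = {x. x \<in> oint a b \<and> (\<forall>i. x \<in> {l i..u i} \<longrightarrow> h x = k i + primitive (f i) x)}"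
  have "AE x in lborel. \<forall>i. x \<in> {l i..u i} \<longrightarrow> h x = k i + primitive (f i) x"
    using k by (subst AE_all_countable) blast
  then have G: "AE x in M. x \<in> G"
    unfolding AE_M by eventually_elim (simp add: G_def)
  have inc: "ennreal \<bar>h y - h x\<bar> \<le> (\<integral>\<^sup>+s. (if x \<le> s \<and> s < y then ennreal \<bar>h' s\<bar> else 0) \<partial>M)"
    if xy: "x \<in> G" "y \<in> G" "x < y" for x y
  proof -
    obtain i1 i2 where i: "x \<in> {l i1..u i1}" "y \<in> {l i2..u i2}"
      using xy un by (auto simp: G_def oint_eq_einterval)
    define i where "i = max i1 i2"
    have "u i1 \<le> u i" "u i2 \<le> u i" "l i \<le> l i1" "l i \<le> l i2"
      using mono by (auto simp: i_def incseq_def decseq_def)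
    with i have i: "x \<in> {l i..u i}" "y \<in> {l i..u i}" by auto
    have "h y - h x = primitive (f i) y - primitive (f i) x"
    proof -
      have "h x = k i + primitive (f i) x" "h y = k i + primitive (f i) y"
        using xy(1,2) i unfolding G_def by blast+
      then show ?thesis by simp
    qed
    also have "\<dots> = (\<integral>s. f i s * indicator {x..<y} s \<partial>lborel)"
      using f xy by (intro primitive_diff) auto
    finally have "ennreal \<bar>h y - h x\<bar> \<le> (\<integral>\<^sup>+s. norm (f i s * indicator {x..<y} s) \<partial>lborel)"
      using integral_norm_bound_ennreal[OF integrable_real_mult_indicator[OF _ f], of "{x..<y}" i] by simp
    also have "\<dots> \<le> (\<integral>\<^sup>+s. indicator (oint a b) s * (if x \<le> s \<and> s < y then ennreal \<bar>h' s\<bar> else 0) \<partial>lborel)"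
      using Icc_subset_oint[OF lu(2,3), of i i]
      by (intro nn_integral_mono) (auto simp: f_def split: split_indicator)
    also have "\<dots> = (\<integral>\<^sup>+s. (if x \<le> s \<and> s < y then ennreal \<bar>h' s\<bar> else 0) \<partial>M)"
      by (intro nn_integral_M[symmetric]) measurable
    finally show ?thesis .
  qed
  from G show ?thesis
    by (rule eventually_mono) (use G inc in \<open>auto elim: eventually_mono\<close>)
qed

lemma AE_mu: "AE x in M. P x \<Longrightarrow> AE x in \<mu>. P x"
  unfolding \<mu>_def by (subst AE_density) (auto elim: eventually_mono)

text \<open>Increments of \<open>h\<close> are dominated by those of a primitive of the modulus of
  \<open>h'\<close>, and the latter carries the same weighted norm. The hypothesis is applied to
  that modulus, which is nonnegative.\<close>

lemma poincare_constI:
  assumes c: "0 \<le> c" and form: "\<And>f. f \<in> borel_measurable borel \<Longrightarrow> kform f \<le> ennreal c * sqnorm f"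
  shows "c \<in> poincare_consts a b p w"
  unfolding poincare_consts_def
proof (intro CollectI conjI c allI impI)
  fix h h' assume "L2w a b p h \<and> weak_deriv a b h h' \<and> L2w a b (\<lambda>x. p x * w x) h'"
  then have h: "L2w a b p h" and wd: "weak_deriv a b h h'" and h': "L2w a b (\<lambda>x. p x * w x) h'" by auto
  have [measurable]: "h \<in> borel_measurable borel" "h' \<in> borel_measurable borel"
    using h h' by (auto simp: L2w_def)
  let ?I = "LINT x:oint a b|lborel. (h' x)\<^sup>2 * w x * p x"
  let ?W = "\<lambda>x y. \<integral>\<^sup>+s. (if x \<le> s \<and> s < y then ennreal \<bar>h' s\<bar> else 0) \<partial>M"
  have "ennreal (Var_p a b p h) = (\<integral>\<^sup>+x. \<integral>\<^sup>+y. (if x < y then ennreal ((h y - h x)\<^sup>2) else 0) \<partial>\<mu> \<partial>\<mu>)"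
    by (rule Var_p_eq_increments[OF h])
  also have "\<dots> \<le> (\<integral>\<^sup>+x. \<integral>\<^sup>+y. (?W x y)\<^sup>2 \<partial>\<mu> \<partial>\<mu>)"
  proof (rule nn_integral_mono_AE, use AE_mu[OF weak_deriv_increment_le[OF wd \<open>h' \<in> borel_measurable borel\<close>]] in eventually_elim)
    fix x assume x: "AE y in M. x < y \<longrightarrow> ennreal \<bar>h y - h x\<bar> \<le> ?W x y"
    show "(\<integral>\<^sup>+y. (if x < y then ennreal ((h y - h x)\<^sup>2) else 0) \<partial>\<mu>) \<le> (\<integral>\<^sup>+y. (?W x y)\<^sup>2 \<partial>\<mu>)"
    proof (rule nn_integral_mono_AE, use AE_mu[OF x] in eventually_elim)
      fix y assume y: "x < y \<longrightarrow> ennreal \<bar>h y - h x\<bar> \<le> ?W x y"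
      show "(if x < y then ennreal ((h y - h x)\<^sup>2) else 0) \<le> (?W x y)\<^sup>2"
      proof (cases "x < y")
        case True
        have "ennreal ((h y - h x)\<^sup>2) = (ennreal \<bar>h y - h x\<bar>)\<^sup>2" by (simp add: ennreal_power)
        also have "\<dots> \<le> (?W x y)\<^sup>2" using y True by (intro power_mono) auto
        finally show ?thesis using True by simp
      qed simp
    qed
  qed measurable
  also have "\<dots> = kform (\<lambda>s. \<bar>h' s\<bar>)" by (rule kform_eq_increments[symmetric]) measurable
  also have "\<dots> \<le> ennreal c * sqnorm (\<lambda>s. \<bar>h' s\<bar>)" by (rule form) measurable
  also have "sqnorm (\<lambda>s. \<bar>h' s\<bar>) = sqnorm h'" by (simp add: sqnorm_def)
  also have "\<dots> = ennreal ?I" by (rule sqnorm_eq[OF h'])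
  finally have "ennreal (Var_p a b p h) \<le> ennreal (c * ?I)" using c by (simp add: ennreal_mult')
  \<comment> \<open>Needed to read the \<open>ennreal\<close> inequality as one between reals: a
    negative right-hand side would have been truncated to 0.\<close>
  moreover have "0 \<le> ?I"
  proof -
    have "AE x in M. 0 \<le> (h' x)\<^sup>2 * w x * p x" using AE_M_pos by eventually_elim simp
    then have "0 \<le> (\<integral>x. (h' x)\<^sup>2 * w x * p x \<partial>M)" by (rule integral_nonneg_AE)
    then show ?thesis by (simp add: integral_M)
  qed
  ultimately show "Var_p a b p h \<le> c * ?I" using c by (simp add: ennreal_le_iff)
qed

text \<open>The primitive of \<open>f\<close> is bounded, hence square-integrable for a probability
  measure and a legitimate test function. Because \<open>f \<ge> 0\<close>, its increments are
  exactly the window integrals, so its variance equals the form.\<close>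

lemma poincare_constD_compact:
  assumes c: "c \<in> poincare_consts a b p w"
    and f: "integrable lborel f" and nonneg: "\<And>x. 0 \<le> f x" and supp: "\<And>x. x \<notin> oint a b \<Longrightarrow> f x = 0"
    and L2: "L2w a b (\<lambda>x. p x * w x) f"
  shows "kform f \<le> ennreal c * sqnorm f"
proof -
  interpret mu: finite_measure \<mu> by (rule finite_mu)
  have [measurable]: "f \<in> borel_measurable borel" using borel_measurable_integrable[OF f] by simp
  note F_meas[measurable] = primitive_measurable[OF f]
  have "integrable \<mu> (\<lambda>x. (primitive f x)\<^sup>2)"
  proof (rule mu.integrable_const_bound)
    show "AE x in \<mu>. norm ((primitive f x)\<^sup>2) \<le> (\<integral>s. \<bar>f s\<bar> \<partial>lborel)\<^sup>2"
    proof (intro AE_I2)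
      fix x
      have "\<bar>primitive f x\<bar>\<^sup>2 \<le> (\<integral>s. \<bar>f s\<bar> \<partial>lborel)\<^sup>2"
        using abs_primitive_le[OF f, of x] by (intro power_mono) auto
      then show "norm ((primitive f x)\<^sup>2) \<le> (\<integral>s. \<bar>f s\<bar> \<partial>lborel)\<^sup>2" by simp
    qed
  qed measurable
  then have L2F: "L2w a b p (primitive f)" by (simp add: L2w_def integrable_mu)
  have "Var_p a b p (primitive f) \<le> c * (LINT x:oint a b|lborel. (f x)\<^sup>2 * w x * p x)"
    using c L2F L2 weak_deriv_primitive[OF f, of a b] unfolding poincare_consts_def by blast
  then have "ennreal (Var_p a b p (primitive f)) \<le> ennreal (c * (LINT x:oint a b|lborel. (f x)\<^sup>2 * w x * p x))"
    by (rule ennreal_leI)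
  also have "\<dots> = ennreal c * sqnorm f"
    using c by (simp add: sqnorm_eq[OF L2] ennreal_mult' poincare_consts_def)
  finally have "ennreal (Var_p a b p (primitive f)) \<le> ennreal c * sqnorm f" .
  moreover have "ennreal (Var_p a b p (primitive f)) = kform f"
    unfolding Var_p_eq_increments[OF L2F] kform_eq_increments[OF \<open>f \<in> borel_measurable borel\<close>]
  proof (intro nn_integral_cong)
    fix x y
    show "(if x < y then ennreal ((primitive f y - primitive f x)\<^sup>2) else 0)
        = (\<integral>\<^sup>+s. (if x \<le> s \<and> s < y then ennreal (f s) else 0) \<partial>M)\<^sup>2"
    proof (cases "x < y")
      case True
      have "(\<integral>\<^sup>+s. (if x \<le> s \<and> s < y then ennreal (f s) else 0) \<partial>M)
          = (\<integral>\<^sup>+s. indicator (oint a b) s * (if x \<le> s \<and> s < y then ennreal (f s) else 0) \<partial>lborel)"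
        by (intro nn_integral_M) measurable
      also have "\<dots> = (\<integral>\<^sup>+s. ennreal (f s * indicator {x..<y} s) \<partial>lborel)"
        by (intro nn_integral_cong) (auto simp: supp split: split_indicator)
      also have "\<dots> = ennreal (\<integral>s. f s * indicator {x..<y} s \<partial>lborel)"
        using f nonneg by (intro nn_integral_eq_integral integrable_real_mult_indicator) auto
      also have "(\<integral>s. f s * indicator {x..<y} s \<partial>lborel) = primitive f y - primitive f x"
        using f True by (intro primitive_diff[symmetric]) auto
      finally have eq: "(\<integral>\<^sup>+s. (if x \<le> s \<and> s < y then ennreal (f s) else 0) \<partial>M) = ennreal (primitive f y - primitive f x)" .
      have "0 \<le> primitive f y - primitive f x"
        using f True nonneg by (subst primitive_diff) auto
      then show ?thesis unfolding eq using True by (simp add: ennreal_power)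
    next
      case False
      then have "(\<lambda>s. if x \<le> s \<and> s < y then ennreal (f s) else 0) = (\<lambda>_. 0)" by auto
      then show ?thesis using False by simp
    qed
  qed
  ultimately show ?thesis by simp
qed

text \<open>\<open>H2\<close> makes the positive part of \<open>f\<close> locally integrable;
  cutting it off to compact intervals gives functions covered by the previous case, with norms at
  most that of \<open>f\<close>. Passing to the positive part leaves \<open>kform f\<close>
  unchanged.\<close>

lemma poincare_constD:
  assumes c: "c \<in> poincare_consts a b p w"
    and H2: "\<forall>f. L2w a b (\<lambda>x. p x * w x) f \<longrightarrow> loc_int a b f"
    and [measurable]: "f \<in> borel_measurable borel" and fin: "sqnorm f < \<infinity>"
  shows "kform f \<le> ennreal c * sqnorm f"
proof -
  obtain u l :: "nat \<Rightarrow> real" where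
    un: "einterval a b = (\<Union>i. {l i .. u i})" and mono: "incseq u" "decseq l"
    and lu: "\<And>i. a < ereal (l i)" "\<And>i. ereal (u i) < b"
    by (rule einterval_Icc_approximation[OF ab]) (rule that; assumption)
  define F where "F k x = indicator {l k..u k} x * max 0 (f x)" for k x
  have F_meas[measurable]: "F k \<in> borel_measurable borel" for k unfolding F_def[abs_def] by measurable
  have sub: "{l i..u i} \<subseteq> {l j..u j}" if "i \<le> j" for i j
    using mono that by (auto simp: incseq_def decseq_def intro: order_trans)
  have sq_le: "sqnorm g \<le> sqnorm f" if "\<And>x. \<bar>g x\<bar> \<le> \<bar>f x\<bar>" for g
    unfolding sqnorm_def
  proof (rule nn_integral_mono_AE, use q_pos in eventually_elim)
    fix x assume "0 < p x * w x"
    moreover have "(g x)\<^sup>2 \<le> (f x)\<^sup>2" using that by (simp add: abs_le_square_iff)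
    ultimately show "ennreal ((g x)\<^sup>2 * (p x * w x)) \<le> ennreal ((f x)\<^sup>2 * (p x * w x))"
      by (intro ennreal_leI mult_right_mono) auto
  qed
  have le: "sqnorm (F k) \<le> sqnorm f" "sqnorm (\<lambda>x. max 0 (f x)) \<le> sqnorm f" for k
    by (auto intro!: sq_le simp: F_def split: split_indicator)
  show ?thesis
  proof (rule kform_le_of_exhaustion)
    fix k
    have "loc_int a b (\<lambda>x. max 0 (f x))"
      using le(2) fin by (intro H2[rule_format]) (simp add: L2w_iff_sqnorm)
    then have "integrable lborel (F k)"
      using lu unfolding loc_int_def F_def set_integrable_def by simp
    moreover have "F k x = 0" if "x \<notin> oint a b" for x
      using that Icc_subset_oint[OF lu, of k k] by (auto simp: F_def split: split_indicator)
    moreover have "L2w a b (\<lambda>x. p x * w x) (F k)"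
      using le(1)[of k] fin by (simp add: L2w_iff_sqnorm)
    ultimately have "kform (F k) \<le> ennreal c * sqnorm (F k)"
      by (intro poincare_constD_compact[OF c]) (auto simp: F_def)
    also have "\<dots> \<le> ennreal c * sqnorm f" using le(1) by (rule mult_left_mono) simp
    finally show "kform (F k) \<le> ennreal c * sqnorm f" .
  next
    show "incseq (\<lambda>k. F k x)" for x
      unfolding incseq_def
    proof (intro allI impI)
      fix i j :: nat assume "i \<le> j"
      with sub[of i j] show "F i x \<le> F j x" by (auto simp: F_def split: split_indicator)
    qed
    show "AE x in M. \<exists>j. \<forall>k\<ge>j. ennreal (F k x) = ennreal (f x)"
      using AE_M_oint
    proof eventually_elim
      fix x assume "x \<in> oint a b"
      then obtain j where j: "x \<in> {l j..u j}" using un by (auto simp: oint_eq_einterval)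
      have "ennreal (F k x) = ennreal (f x)" if "j \<le> k" for k
        using sub[OF that] j by (auto simp: F_def max_def ennreal_neg split: split_indicator)
      then show "\<exists>j. \<forall>k\<ge>j. ennreal (F k x) = ennreal (f x)" by blast
    qed
  qed measurable
qed

section \<open>Strict positivity and the pointwise operator\<close>

lemma Ltil_measurable[measurable]:
  assumes [measurable]: "g \<in> borel_measurable borel"
  shows "Ltil a b p w g \<in> borel_measurable borel"
  unfolding Ltil_def[abs_def] set_lebesgue_integral_def by measurable

lemma not_AE_M_False: "\<not> (AE x in M. False)"
proof
  assume "AE x in M. False"
  then have "AE y in \<mu>. False" by (rule AE_mu)
  then have "emeasure \<mu> UNIV = 0" by (subst (asm) AE_iff_measurable[of UNIV]) auto
  then show False by (simp add: emeasure_mu_UNIV)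
qed

lemma kop_pos:
  assumes [measurable]: "g \<in> borel_measurable borel" and g: "AE x in M. 0 < g x" and x: "x \<in> oint a b"
  shows "0 < kop g x"
proof (rule ccontr)
  assume "\<not> 0 < kop g x"
  then have "(\<integral>\<^sup>+y. ennreal (kernK a p x y) * ennreal (g y) \<partial>M) = 0" by (simp add: kop_def)
  then have "AE y in M. ennreal (kernK a p x y) * ennreal (g y) = 0"
    by (subst (asm) nn_integral_0_iff_AE) auto
  with g AE_M_oint have "AE y in M. False"
  proof eventually_elim
    fix y assume "0 < g y" "y \<in> oint a b" "ennreal (kernK a p x y) * ennreal (g y) = 0"
    then show False using kernK_pos[OF x] by (auto simp: ennreal_eq_0_iff not_le[symmetric])
  qed
  then show False using not_AE_M_False by simp
qed

text \<open>The class preserved by the iteration: positivity makes the ratios meaningful and allows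
  \<open>g\<close> as a Schur weight, and the finite norm allows \<open>g\<close> in the form
  bound.\<close>

definition admissible :: "(real \<Rightarrow> real) \<Rightarrow> bool" where
  "admissible g \<longleftrightarrow> g \<in> borel_measurable borel \<and> (AE x in M. 0 < g x) \<and> sqnorm g < \<infinity>"

lemma sqnorm_pos:
  assumes "admissible g"
  shows "0 < sqnorm g"
proof (rule ccontr)
  have [measurable]: "g \<in> borel_measurable borel" and g: "AE x in M. 0 < g x"
    using assms by (auto simp: admissible_def)
  assume "\<not> 0 < sqnorm g"
  then have "AE x in M. ennreal ((g x)\<^sup>2 * (p x * w x)) = 0"
    unfolding sqnorm_def by (simp add: nn_integral_0_iff_AE)
  with g q_pos have "AE x in M. False"
    by eventually_elim (auto simp: ennreal_eq_0_iff mult_le_0_iff zero_less_mult_iff)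
  then show False using not_AE_M_False by simp
qed

text \<open>\<open>enn2real\<close> maps \<open>\<infinity>\<close> to 0, just as the Bochner
  integral of a nonnegative nonintegrable function is 0, so the identity holds before
  \<open>kop g x\<close> is known to be finite.\<close>

lemma Ltil_eq_kop:
  assumes [measurable]: "g \<in> borel_measurable borel" and g: "AE x in M. 0 < g x" and x: "x \<in> oint a b"
  shows "Ltil a b p w g x = enn2real (kop g x) / (p x * w x)"
proof -
  have "(LINT y:oint a b|lborel. kernK a p x y * g y) = (\<integral>y. kernK a p x y * g y \<partial>M)"
    by (intro integral_M[symmetric]) measurable
  also have "\<dots> = enn2real (\<integral>\<^sup>+y. ennreal (kernK a p x y * g y) \<partial>M)"
  proof (rule integral_eq_nn_integral)
    show "AE y in M. 0 \<le> kernK a p x y * g y"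
      using g AE_M_oint by eventually_elim (simp add: kernK_pos[OF x] less_imp_le)
  qed measurable
  also have "(\<integral>\<^sup>+y. ennreal (kernK a p x y * g y) \<partial>M) = kop g x"
    unfolding kop_def
    by (rule nn_integral_cong_AE, use AE_M_oint in eventually_elim)
      (simp add: kernK_pos[OF x] less_imp_le ennreal_mult')
  finally show ?thesis by (simp add: Ltil_def)
qed

section \<open>Iterates, propagation of ratio bounds and location of the optimal constant\<close>

context
  assumes H1: "poincare_consts a b p w \<noteq> {}"
    and H2: "\<forall>f. L2w a b (\<lambda>x. p x * w x) f \<longrightarrow> loc_int a b f"
begin

text \<open>Square integrability of \<open>kop g\<close> over the weight yields almost-everywhere
  finiteness. This removes the ambiguity of \<open>enn2real\<close> and transfers norm and
  positivity to \<open>Ltil\<close>.\<close>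

lemma Ltil_step:
  assumes g: "admissible g"
  shows "AE x in M. kop g x = ennreal (Ltil a b p w g x * (p x * w x))"
    and "admissible (Ltil a b p w g)"
proof -
  have [measurable]: "g \<in> borel_measurable borel" and g_pos: "AE x in M. 0 < g x" and g_fin: "sqnorm g < \<infinity>"
    using g by (auto simp: admissible_def)
  obtain c where c: "c \<in> poincare_consts a b p w" using H1 by blast
  then have "0 \<le> c" by (simp add: poincare_consts_def)
  \<comment> \<open>A Poincare constant is only known to be nonnegative, while the absorption
    argument divides by it; enlarging it by 1 makes it positive.\<close>
  have bound: "kform f \<le> ennreal (c + 1) * sqnorm f" if "f \<in> borel_measurable M" "sqnorm f < \<infinity>" for f
  proof -
    have "kform f \<le> ennreal c * sqnorm f" using that by (intro poincare_constD[OF c H2]) auto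
    also have "\<dots> \<le> ennreal (c + 1) * sqnorm f" by (intro mult_right_mono ennreal_leI) auto
    finally show ?thesis .
  qed
  have fin: "(\<integral>\<^sup>+x. (kop g x / ennreal (p x * w x))\<^sup>2 * ennreal (p x * w x) \<partial>M) < \<infinity>"
    using \<open>0 \<le> c\<close> g_pos g_fin bound by (intro kop_square_integrable[of g "c + 1"]) auto
  then have "AE x in M. (kop g x / ennreal (p x * w x))\<^sup>2 * ennreal (p x * w x) \<noteq> \<infinity>"
    by (intro nn_integral_PInf_AE) auto
  \<comment> \<open>The weight is positive and finite, so an infinite \<open>kop g x\<close> would
    make the integrand infinite at \<open>x\<close>.\<close>
  then have kop_fin: "AE x in M. kop g x \<noteq> \<infinity>"
    using q_pos
    by eventually_elim (auto simp: ennreal_top_divide ennreal_top_mult ennreal_eq_0_iff power2_eq_square)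
  show eq: "AE x in M. kop g x = ennreal (Ltil a b p w g x * (p x * w x))"
    using kop_fin q_pos AE_M_oint
  proof eventually_elim
    fix x assume "kop g x \<noteq> \<infinity>" "0 < p x * w x" and x: "x \<in> oint a b"
    then show "kop g x = ennreal (Ltil a b p w g x * (p x * w x))"
      using Ltil_eq_kop[OF _ g_pos x] by (auto simp: less_top zero_less_mult_iff)
  qed
  have pos: "AE x in M. 0 < Ltil a b p w g x"
    using eq q_pos AE_M_oint
  proof eventually_elim
    fix x assume x: "kop g x = ennreal (Ltil a b p w g x * (p x * w x))" "0 < p x * w x" "x \<in> oint a b"
    have "0 < kop g x" by (rule kop_pos[OF _ g_pos x(3)]) measurable
    then have "0 < Ltil a b p w g x * (p x * w x)" using x(1) by simp
    then show "0 < Ltil a b p w g x" using x(2) by (simp add: zero_less_mult_iff)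
  qed
  have "sqnorm (Ltil a b p w g) = (\<integral>\<^sup>+x. (kop g x / ennreal (p x * w x))\<^sup>2 * ennreal (p x * w x) \<partial>M)"
    unfolding sqnorm_def
  proof (rule nn_integral_cong_AE, use eq q_pos pos in eventually_elim)
    fix x assume x: "kop g x = ennreal (Ltil a b p w g x * (p x * w x))" "0 < p x * w x" "0 < Ltil a b p w g x"
    have "kop g x / ennreal (p x * w x) = ennreal (Ltil a b p w g x)"
      using x less_imp_neq[OF x(2)] by (simp add: divide_ennreal)
    then show "ennreal ((Ltil a b p w g x)\<^sup>2 * (p x * w x)) = (kop g x / ennreal (p x * w x))\<^sup>2 * ennreal (p x * w x)"
      using x by (simp add: ennreal_mult'' ennreal_power)
  qed
  then show "admissible (Ltil a b p w g)"
    using fin pos by (simp add: admissible_def)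
qed

text \<open>Applying the monotone operator to \<open>m * g \<le> g1\<close> and cancelling the
  weight gives \<open>m * g1 \<le> g2\<close>. The threshold is an arbitrary extended real because
  \<open>ess_inf_on\<close> is a supremum over \<open>ereal\<close>. Homogeneity of
  \<open>kop\<close> requires \<open>m \<ge> 0\<close>; a negative \<open>m\<close> lies below the
  positive ratio anyway, and \<open>z = \<infinity>\<close> contradicts the hypothesis
  pointwise.\<close>

lemma ratio_ge_step:
  assumes g: "admissible g" and z: "AE x in M. z \<le> ereal (Ltil a b p w g x / g x)"
  shows "AE x in M. z \<le> ereal (Ltil a b p w (Ltil a b p w g) x / Ltil a b p w g x)"
proof -
  define g1 where "g1 = Ltil a b p w g"
  define g2 where "g2 = Ltil a b p w g1"
  have g1: "admissible g1" and g2: "admissible g2" using g Ltil_step(2) by (auto simp: g1_def g2_def)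
  have [measurable]: "g \<in> borel_measurable borel" "g1 \<in> borel_measurable borel"
    and pos: "AE x in M. 0 < g x" "AE x in M. 0 < g1 x" "AE x in M. 0 < g2 x"
    using g g1 g2 by (auto simp: admissible_def)
  have kop: "AE x in M. kop g x = ennreal (g1 x * (p x * w x))" "AE x in M. kop g1 x = ennreal (g2 x * (p x * w x))"
    using Ltil_step(1)[OF g] Ltil_step(1)[OF g1] by (auto simp: g1_def g2_def)
  have "AE x in M. z \<le> ereal (g2 x / g1 x)"
  proof (cases z)
    case (real m)
    show ?thesis
    proof (cases "0 \<le> m")
      case True
      have le: "AE x in M. m * g x \<le> g1 x"
        using z pos(1) by eventually_elim (simp add: real g1_def field_simps)
      from kop pos q_pos show ?thesis
      proof eventually_elim
        fix x assume x: "kop g x = ennreal (g1 x * (p x * w x))" "kop g1 x = ennreal (g2 x * (p x * w x))"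
          "0 < g x" "0 < g1 x" "0 < g2 x" "0 < p x * w x"
        have "ennreal (m * (g1 x * (p x * w x))) = kop (\<lambda>y. m * g y) x"
          using True x by (simp add: kop_cmult ennreal_mult')
        also have "\<dots> \<le> kop g1 x" by (rule kop_mono_AE[OF le])
        finally have "m * (g1 x * (p x * w x)) \<le> g2 x * (p x * w x)"
          using x by (simp add: ennreal_le_iff)
        then have "m * g1 x \<le> g2 x"
          using x(6) by (metis mult.assoc mult_le_cancel_right_pos)
        then show "z \<le> ereal (g2 x / g1 x)" using x by (simp add: real field_simps)
      qed
    next
      case False
      from pos show ?thesis
        by eventually_elim (use False in \<open>auto simp: real intro: order_trans[of _ 0]\<close>)
    qed
  next
    case PInf
    from z show ?thesis by eventually_elim (simp add: PInf)
  qed simp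
  then show ?thesis by (simp add: g1_def g2_def)
qed

text \<open>The ratio is positive on a set of positive measure. For upper thresholds this leaves
  only nonnegative reals, for which \<open>kop\<close> is homogeneous, and the trivial value
  \<open>\<infinity>\<close>.\<close>

lemma ratio_le_nonneg:
  assumes g: "admissible g" and z: "AE x in M. ereal (Ltil a b p w g x / g x) \<le> z"
  shows "0 \<le> z"
proof (rule ccontr)
  assume neg: "\<not> 0 \<le> z"
  have "AE x in M. 0 < g x" "AE x in M. 0 < Ltil a b p w g x"
    using g Ltil_step(2)[OF g] by (auto simp: admissible_def)
  with z have "AE x in M. False"
  proof eventually_elim
    fix x assume x: "ereal (Ltil a b p w g x / g x) \<le> z" "0 < g x" "0 < Ltil a b p w g x"
    then have "0 \<le> ereal (Ltil a b p w g x / g x)" by simp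
    then show False using neg x(1) by (metis order_trans)
  qed
  then show False using not_AE_M_False by simp
qed

lemma ratio_le_step:
  assumes g: "admissible g" and z: "AE x in M. ereal (Ltil a b p w g x / g x) \<le> z"
  shows "AE x in M. ereal (Ltil a b p w (Ltil a b p w g) x / Ltil a b p w g x) \<le> z"
proof -
  define g1 where "g1 = Ltil a b p w g"
  define g2 where "g2 = Ltil a b p w g1"
  have g1: "admissible g1" and g2: "admissible g2" using g Ltil_step(2) by (auto simp: g1_def g2_def)
  have [measurable]: "g \<in> borel_measurable borel" "g1 \<in> borel_measurable borel"
    and pos: "AE x in M. 0 < g x" "AE x in M. 0 < g1 x" "AE x in M. 0 < g2 x"
    using g g1 g2 by (auto simp: admissible_def)
  have kop: "AE x in M. kop g x = ennreal (g1 x * (p x * w x))" "AE x in M. kop g1 x = ennreal (g2 x * (p x * w x))"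
    using Ltil_step(1)[OF g] Ltil_step(1)[OF g1] by (auto simp: g1_def g2_def)
  have z0: "0 \<le> z" by (rule ratio_le_nonneg[OF g z])
  have "AE x in M. ereal (g2 x / g1 x) \<le> z"
  proof (cases z)
    case (real m)
    then have m: "0 \<le> m" using z0 by simp
    have le: "AE x in M. g1 x \<le> m * g x"
      using z pos(1) by eventually_elim (simp add: real g1_def field_simps)
    from kop pos q_pos show ?thesis
    proof eventually_elim
      fix x assume x: "kop g x = ennreal (g1 x * (p x * w x))" "kop g1 x = ennreal (g2 x * (p x * w x))"
        "0 < g x" "0 < g1 x" "0 < g2 x" "0 < p x * w x"
      have "kop g1 x \<le> kop (\<lambda>y. m * g y) x" by (rule kop_mono_AE[OF le])
      also have "\<dots> = ennreal (m * (g1 x * (p x * w x)))"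
        using m x by (simp add: kop_cmult ennreal_mult')
      finally have "g2 x * (p x * w x) \<le> m * (g1 x * (p x * w x))"
        using x m by (simp add: ennreal_le_iff)
      then have "g2 x \<le> m * g1 x"
        using x(6) by (metis mult.assoc mult_le_cancel_right_pos)
      then show "ereal (g2 x / g1 x) \<le> z" using x by (simp add: real field_simps)
    qed
  qed (use z0 in auto)
  then show ?thesis by (simp add: g1_def g2_def)
qed

lemma Cpw_le:
  assumes g: "admissible g" and z: "AE x in M. ereal (Ltil a b p w g x / g x) \<le> z"
  shows "ereal (Cpw a b p w) \<le> z"
proof -
  have [measurable]: "g \<in> borel_measurable borel" and pos: "AE x in M. 0 < g x"
    using g by (auto simp: admissible_def)
  have z0: "0 \<le> z" by (rule ratio_le_nonneg[OF g z])
  show ?thesis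
  proof (cases z)
    case (real m)
    then have m: "0 \<le> m" using z0 by simp
    have "AE x in M. kop g x \<le> ennreal (m * g x * (p x * w x))"
      using z pos q_pos Ltil_step(1)[OF g]
    proof eventually_elim
      fix x assume x: "ereal (Ltil a b p w g x / g x) \<le> z" "0 < g x" "0 < p x * w x"
        "kop g x = ennreal (Ltil a b p w g x * (p x * w x))"
      then have "Ltil a b p w g x \<le> m * g x" by (simp add: real field_simps)
      then show "kop g x \<le> ennreal (m * g x * (p x * w x))"
        unfolding x(4) using x(3) by (intro ennreal_leI mult_right_mono) auto
    qed
    \<comment> \<open>Schur's test with weight \<open>g\<close> makes the threshold itself a
      Poincare constant, and \<open>Cpw\<close> is the infimum of these constants, all of them
      nonnegative.\<close>
    then have "m \<in> poincare_consts a b p w"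
      using pos m by (intro poincare_constI kform_le_of_supersolution[of _ g]) auto
    then have "Cpw a b p w \<le> m"
      unfolding Cpw_def by (rule cInf_lower) (auto simp: poincare_consts_def intro!: bdd_belowI[of _ 0])
    then show ?thesis by (simp add: real)
  qed (use z0 in auto)
qed

text \<open>The threshold is compared with each Poincare constant separately, so the infimum need
  not be attained; \<open>H1\<close> is what turns a common lower bound into a bound on
  \<open>Inf\<close>.\<close>

lemma Cpw_ge:
  assumes g: "admissible g" and z: "AE x in M. z \<le> ereal (Ltil a b p w g x / g x)"
  shows "z \<le> ereal (Cpw a b p w)"
proof (cases z)
  case (real m)
  have [measurable]: "g \<in> borel_measurable borel" and pos: "AE x in M. 0 < g x" and fin: "sqnorm g < \<infinity>"
    using g by (auto simp: admissible_def)
  have "m \<le> c" if c: "c \<in> poincare_consts a b p w" for c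
  proof (cases "0 \<le> m")
    case True
    have "ennreal m * sqnorm g = (\<integral>\<^sup>+x. ennreal m * ennreal ((g x)\<^sup>2 * (p x * w x)) \<partial>M)"
      unfolding sqnorm_def by (intro nn_integral_cmult[symmetric]) measurable
    also have "\<dots> \<le> kform g"
      unfolding kform_def
    proof (rule nn_integral_mono_AE, use z pos q_pos Ltil_step(1)[OF g] in eventually_elim)
      fix x assume x: "z \<le> ereal (Ltil a b p w g x / g x)" "0 < g x" "0 < p x * w x"
        "kop g x = ennreal (Ltil a b p w g x * (p x * w x))"
      then have "m * g x \<le> Ltil a b p w g x" by (simp add: real field_simps)
      then have "g x * (m * g x * (p x * w x)) \<le> g x * (Ltil a b p w g x * (p x * w x))"
        using x by (intro mult_left_mono mult_right_mono) auto
      then have "m * ((g x)\<^sup>2 * (p x * w x)) \<le> g x * (Ltil a b p w g x * (p x * w x))"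
        by (simp add: power2_eq_square ac_simps)
      then show "ennreal m * ennreal ((g x)\<^sup>2 * (p x * w x)) \<le> ennreal (g x) * kop g x"
        unfolding x(4) using x(2) True by (simp add: ennreal_leI flip: ennreal_mult')
    qed
    also have "\<dots> \<le> ennreal c * sqnorm g"
      by (rule poincare_constD[OF c H2 _ fin]) measurable
    \<comment> \<open>Cancelling \<open>sqnorm g\<close> in \<open>ennreal\<close> requires it to be
      both nonzero and finite.\<close>
    finally have "ennreal m \<le> ennreal c"
      using sqnorm_pos[OF g] fin by (simp add: mult.commute[of _ "sqnorm g"] ennreal_mult_le_mult_iff less_top)
    then show ?thesis using c True by (auto simp: poincare_consts_def ennreal_le_iff)
  next
    case False
    then show ?thesis using c by (simp add: poincare_consts_def)
  qed
  then show ?thesis unfolding real Cpw_def using H1 by (simp add: cInf_greatest)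
next
  case PInf
  from z have "AE x in M. False" by eventually_elim (simp add: PInf)
  then show ?thesis using not_AE_M_False by simp
qed simp

end

end

theorem theorem3p4:
  fixes a b :: ereal and p w g0 :: "real \<Rightarrow> real" and x0 :: real
  assumes ab: "a < b"
    and p_meas: "p \<in> borel_measurable lborel"
    and p_int: "set_integrable lborel (oint a b) p"
    and p_one: "(LINT x:oint a b|lborel. p x) = 1"
    and p_pos: "AE x in lborel. x \<in> oint a b \<longrightarrow> p x > 0"
    and w_meas: "w \<in> borel_measurable lborel"
    and w_loc: "loc_int a b w"
    and w_pos: "AE x in lborel. x \<in> oint a b \<longrightarrow> w x > 0"
    and pw_loc: "loc_int a b (\<lambda>x. p x * w x)"
    and H1: "poincare_consts a b p w \<noteq> {}"
    and H2: "\<forall>f. L2w a b (\<lambda>x. p x * w x) f \<longrightarrow> loc_int a b f"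
    and x0: "x0 \<in> oint a b"
    and g0_E2: "g0 \<in> E2 a b p w x0"
    and g0_pos: "AE x in lborel. x \<in> oint a b \<longrightarrow> g0 x > 0"
  shows "\<forall>n::nat.
           {ess_inf_on a b (\<lambda>x. (Ltil a b p w ^^ (Suc (Suc n))) g0 x / (Ltil a b p w ^^ (Suc n)) g0 x) ..
            ess_sup_on a b (\<lambda>x. (Ltil a b p w ^^ (Suc (Suc n))) g0 x / (Ltil a b p w ^^ (Suc n)) g0 x)}
         \<subseteq>
           {ess_inf_on a b (\<lambda>x. (Ltil a b p w ^^ (Suc n)) g0 x / (Ltil a b p w ^^ n) g0 x) ..
            ess_sup_on a b (\<lambda>x. (Ltil a b p w ^^ (Suc n)) g0 x / (Ltil a b p w ^^ n) g0 x)}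
       \<and> (\<forall>n::nat. ereal (Cpw a b p w) \<in>
           {ess_inf_on a b (\<lambda>x. (Ltil a b p w ^^ (Suc n)) g0 x / (Ltil a b p w ^^ n) g0 x) ..
            ess_sup_on a b (\<lambda>x. (Ltil a b p w ^^ (Suc n)) g0 x / (Ltil a b p w ^^ n) g0 x)})"
proof -
  interpret weighted_interval a b p w
    using ab p_meas p_int p_one p_pos w_meas w_pos by unfold_locales simp_all
  define g where "g n = (Ltil a b p w ^^ n) g0" for n
  have g_Suc: "g (Suc n) = Ltil a b p w (g n)" for n by (simp add: g_def)
  have L2: "L2w a b (\<lambda>x. p x * w x) g0" using g0_E2 by (simp add: E2_def)
  then have g0_meas: "g0 \<in> borel_measurable borel" by (simp add: L2w_def)
  have adm: "admissible (g n)" for n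
  proof (induction n)
    case 0
    show ?case
      using L2 g0_meas g0_pos L2w_iff_sqnorm[OF g0_meas] by (simp add: g_def admissible_def AE_M)
  next
    case (Suc n)
    then show ?case unfolding g_Suc by (rule Ltil_step(2)[OF H1 H2])
  qed
  let ?r = "\<lambda>n x. g (Suc n) x / g n x"
  \<comment> \<open>Nesting is proved for thresholds: every essential lower or upper bound of one
    ratio remains one for the next. The sets defining both endpoints only grow, so the supremum
    rises and the infimum falls.\<close>
  have "ess_inf_on a b (?r n) \<le> ess_inf_on a b (?r (Suc n))" for n
    unfolding ess_inf_on_def
    by (intro Sup_subset_mono Collect_mono impI) (use ratio_ge_step[OF H1 H2 adm] in \<open>simp add: g_Suc AE_M\<close>)
  moreover have "ess_sup_on a b (?r (Suc n)) \<le> ess_sup_on a b (?r n)" for n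
    unfolding ess_sup_on_def
    by (intro Inf_superset_mono Collect_mono impI) (use ratio_le_step[OF H1 H2 adm] in \<open>simp add: g_Suc AE_M\<close>)
  moreover have "ess_inf_on a b (?r n) \<le> ereal (Cpw a b p w)" for n
    unfolding ess_inf_on_def
    by (intro Sup_least) (use Cpw_ge[OF H1 H2 adm] in \<open>simp add: g_Suc AE_M\<close>)
  moreover have "ereal (Cpw a b p w) \<le> ess_sup_on a b (?r n)" for n
    unfolding ess_sup_on_def
    by (intro Inf_greatest) (use Cpw_le[OF H1 H2 adm] in \<open>simp add: g_Suc AE_M\<close>)
  ultimately show ?thesis unfolding g_def by auto
qed

end
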